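(* Let $n\ge 2$, let $D$ and $D'$ be domains in $\mathbb{R}^n$, let $f:D\to D'$ be a $K$-quasiconformal mapping, and suppose that $D$ is $\varphi$-broad. Let $A\subset D$ be an arcwise connected set. If the restriction $f|_A:A\to f(A)$ is weakly $H$-quasisymmetric in the metrics $\delta_D$ and $\delta_{D'}$, then $f|_A:A\to f(A)$ is $\eta$-quasisymmetric in the metrics $\delta_D$ and $\delta_{D'}$, with $\eta$ depending only on the data $\mu=(n,K,H,\varphi)$.
   Context: All domains lie in $\mathbb{R}^n$, $n\ge 2$, and $f:D\to D'$ is a homeomorphism onto $D'$. Internal metric: for $x,y\in D$, $\delta_D(x,y)=\inf\operatorname{diam}(\alpha)$, the infimum over all rectifiable arcs $\alpha\subset D$ joining $x$ to $y$ ($\operatorname{diam}$ is Euclidean diameter). For sets $C_0,C_1\subset D$, $\delta_D(C_0,C_1)$ is their $\delta_D$-distance. Modulus: for disjoint continua $E,F\subset G$, $\operatorname{Mod}(E,F;G)$ is the usual conformal ($n$-)modulus of the family of all curves joining $E$ and $F$ in $G$. A homeomorphism is $K$-quasiconformal if $K^{-1}\operatorname{Mod}(\Gamma)\le \operatorname{Mod}(f\Gamma)\le K\operatorname{Mod}(\Gamma)$ for every curve family $\Gamma$ in $D$. Broad domain: let $\varphi:(0,\infty)\to(0,\infty)$ be a decreasing homeomorphism. $D$ is $\varphi$-broad if for each $t>0$ and each pair $(C_0,C_1)$ of disjoint continua in $D$, the condition $\delta_D(C_0,C_1)\le t\min\{\operatorname{diam}(C_0),\operatorname{diam}(C_1)\}$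 implies $\operatorname{Mod}(C_0,C_1;D)\ge\varphi(t)$. Quasisymmetry: let $(X,d)$, $(X',d')$ be metric spaces and $g:X\to X'$ an embedding. For a homeomorphism $\eta:[0,\infty)\to[0,\infty)$, $g$ is $\eta$-quasisymmetric in the metrics $d$ and $d'$ if $d(a,x)\le t\,d(a,y)$ implies $d'(g(a),g(x))\le\eta(t)\,d'(g(a),g(y))$ for all $a,x,y\in X$ (and $t\ge0$). For $\nu\ge1$, $g$ is weakly $\nu$-quasisymmetric if $d(a,x)\le d(a,y)$ implies $d'(g(a),g(x))\le \nu\, d'(g(a),g(y))$ for all $a,x,y\in X$. Here $A$ and $f(A)$ carry the restrictions of $\delta_D$ and $\delta_{D'}$. *)

theory Defs
  imports "HOL-Analysis.Analysis"
begin

definition is_domain :: "'a::euclidean_space set \<Rightarrow> bool" where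
  "is_domain D \<longleftrightarrow> open D \<and> connected D \<and> D \<noteq> {}"

definition continuum :: "'a::euclidean_space set \<Rightarrow> bool" where
  "continuum C \<longleftrightarrow> compact C \<and> connected C \<and> C \<noteq> {}"

definition arcwise_connected :: "'a::euclidean_space set \<Rightarrow> bool" where
  "arcwise_connected A \<longleftrightarrow>
     (\<forall>x\<in>A. \<forall>y\<in>A. x \<noteq> y \<longrightarrow>
        (\<exists>g. arc g \<and> path_image g \<subseteq> A \<and> pathstart g = x \<and> pathfinish g = y))"

text \<open>Length of the part of \<open>g\<close> over \<open>{a..b}\<close>, where \<open>a \<le> b\<close>: the supremum of the
  lengths of inscribed polygons.\<close>

definition curve_length :: "(real \<Rightarrow> 'a::euclidean_space) \<Rightarrow> real \<Rightarrow> real \<Rightarrow> ennreal" where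
  "curve_length g a b =
     (SUP (k, t) \<in> {(k::nat, t::nat \<Rightarrow> real).
                      t 0 = a \<and> t k = b \<and> (\<forall>i<k. t i \<le> t (Suc i))}.
        ennreal (\<Sum>i<k. dist (g (t i)) (g (t (Suc i)))))"

subsection \<open>Internal metric\<close>

text \<open>For \<open>x = y\<close> the constant arc is admitted, so the distance is 0; it is treated
  separately because \<^const>\<open>arc\<close> requires injectivity on \<open>{0..1}\<close>.\<close>

definition internal_dist :: "'a::euclidean_space set \<Rightarrow> 'a \<Rightarrow> 'a \<Rightarrow> real" where
  "internal_dist D x y =
     (if x = y then 0
      else INF g \<in> {g. arc g \<and> curve_length g 0 1 < \<infinity> \<and> path_image g \<subseteq> D \<and>
                       pathstart g = x \<and> pathfinish g = y}. diameter (path_image g))"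

definition internal_setdist :: "'a::euclidean_space set \<Rightarrow> 'a set \<Rightarrow> 'a set \<Rightarrow> real" where
  "internal_setdist D C0 C1 = (INF (x, y) \<in> C0 \<times> C1. internal_dist D x y)"

subsection \<open>Modulus of curve families\<close>

text \<open>A curve is a continuous map on an arbitrary (open, half-open, closed, possibly unbounded)
  interval, represented by the interval together with a total function whose values off the
  interval are irrelevant.\<close>

type_synonym 'a curve = "real set \<times> (real \<Rightarrow> 'a)"

definition is_curve_in :: "'a::euclidean_space set \<Rightarrow> 'a curve \<Rightarrow> bool" where
  "is_curve_in G = (\<lambda>(I, g). is_interval I \<and> I \<noteq> {} \<and> continuous_on I g \<and> g ` I \<subseteq> G)"

definition locally_rectifiable :: "'a::euclidean_space curve \<Rightarrow> bool" where
  "locally_rectifiable =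
     (\<lambda>(I, g). \<forall>a\<in>I. \<forall>b\<in>I. a \<le> b \<longrightarrow> curve_length g a b < \<infinity>)"

text \<open>Parametrization by arc length of the rectifiable curve \<open>g\<close> on \<open>{a..b}\<close>; all choices of
  the parameter give the same value of \<open>g\<close>.\<close>

definition arclength_param :: "(real \<Rightarrow> 'a::euclidean_space) \<Rightarrow> real \<Rightarrow> real \<Rightarrow> real \<Rightarrow> 'a" where
  "arclength_param g a b s = g (SOME t. t \<in> {a..b} \<and> curve_length g a t = ennreal s)"

definition line_integral_on ::
    "('a::euclidean_space \<Rightarrow> ennreal) \<Rightarrow> (real \<Rightarrow> 'a) \<Rightarrow> real \<Rightarrow> real \<Rightarrow> ennreal" where
  "line_integral_on \<rho> g a b =
     (\<integral>\<^sup>+ s \<in> {0 .. enn2real (curve_length g a b)}. \<rho> (arclength_param g a b s) \<partial>lborel)"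

text \<open>For a compact interval the supremum is attained at the whole interval.\<close>

definition line_integral :: "('a::euclidean_space \<Rightarrow> ennreal) \<Rightarrow> 'a curve \<Rightarrow> ennreal" where
  "line_integral \<rho> =
     (\<lambda>(I, g). SUP (a, b) \<in> {(a, b). a \<in> I \<and> b \<in> I \<and> a \<le> b}. line_integral_on \<rho> g a b)"

definition admissible :: "'a::euclidean_space curve set \<Rightarrow> ('a \<Rightarrow> ennreal) \<Rightarrow> bool" where
  "admissible \<Gamma> \<rho> \<longleftrightarrow>
     \<rho> \<in> borel_measurable borel \<and>
     (\<forall>c\<in>\<Gamma>. locally_rectifiable c \<longrightarrow> 1 \<le> line_integral \<rho> c)"

definition modulus :: "'a::euclidean_space curve set \<Rightarrow> ennreal" where
  "modulus \<Gamma> = (INF \<rho> \<in> {\<rho>. admissible \<Gamma> \<rho>}. \<integral>\<^sup>+ x. \<rho> x ^ DIM('a) \<partial>lborel)"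

definition joining_curves ::
    "'a::euclidean_space set \<Rightarrow> 'a set \<Rightarrow> 'a set \<Rightarrow> 'a curve set" where
  "joining_curves E F G =
     {({a..b}, g) | a b g. a \<le> b \<and> is_curve_in G ({a..b}, g) \<and>
        (g a \<in> E \<and> g b \<in> F \<or> g a \<in> F \<and> g b \<in> E)}"

definition image_family ::
    "('a::euclidean_space \<Rightarrow> 'b::euclidean_space) \<Rightarrow> 'a curve set \<Rightarrow> 'b curve set" where
  "image_family f \<Gamma> = (\<lambda>(I, g). (I, f \<circ> g)) ` \<Gamma>"

definition quasiconformal ::
    "real \<Rightarrow> 'a::euclidean_space set \<Rightarrow> 'a set \<Rightarrow> ('a \<Rightarrow> 'a) \<Rightarrow> bool" where
  "quasiconformal K D D' f \<longleftrightarrow>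
     (\<exists>g. homeomorphism D D' f g) \<and>
     (\<forall>\<Gamma>. (\<forall>c\<in>\<Gamma>. is_curve_in D c) \<longrightarrow>
        ennreal (1 / K) * modulus \<Gamma> \<le> modulus (image_family f \<Gamma>) \<and>
        modulus (image_family f \<Gamma>) \<le> ennreal K * modulus \<Gamma>)"

definition broad :: "(real \<Rightarrow> real) \<Rightarrow> 'a::euclidean_space set \<Rightarrow> bool" where
  "broad \<phi> D \<longleftrightarrow>
     (\<forall>t>0. \<forall>C0 C1. continuum C0 \<and> continuum C1 \<and> C0 \<subseteq> D \<and> C1 \<subseteq> D \<and> C0 \<inter> C1 = {} \<and>
        internal_setdist D C0 C1 \<le> t * min (diameter C0) (diameter C1) \<longrightarrow>
        ennreal (\<phi> t) \<le> modulus (joining_curves C0 C1 D))"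

subsection \<open>Quasisymmetry\<close>

definition metric_embedding ::
    "'a set \<Rightarrow> ('a \<Rightarrow> 'a \<Rightarrow> real) \<Rightarrow> 'b set \<Rightarrow> ('b \<Rightarrow> 'b \<Rightarrow> real) \<Rightarrow> ('a \<Rightarrow> 'b) \<Rightarrow> bool" where
  "metric_embedding X d X' d' g \<longleftrightarrow>
     embedding_map (Metric_space.mtopology X d) (Metric_space.mtopology X' d') g"

definition quasisymmetric ::
    "(real \<Rightarrow> real) \<Rightarrow> 'a set \<Rightarrow> ('a \<Rightarrow> 'a \<Rightarrow> real) \<Rightarrow> 'b set \<Rightarrow> ('b \<Rightarrow> 'b \<Rightarrow> real) \<Rightarrow>
     ('a \<Rightarrow> 'b) \<Rightarrow> bool" where
  "quasisymmetric \<eta> X d X' d' g \<longleftrightarrow>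
     metric_embedding X d X' d' g \<and>
     (\<forall>a\<in>X. \<forall>x\<in>X. \<forall>y\<in>X. \<forall>t\<ge>0.
        d a x \<le> t * d a y \<longrightarrow> d' (g a) (g x) \<le> \<eta> t * d' (g a) (g y))"

definition weakly_quasisymmetric ::
    "real \<Rightarrow> 'a set \<Rightarrow> ('a \<Rightarrow> 'a \<Rightarrow> real) \<Rightarrow> 'b set \<Rightarrow> ('b \<Rightarrow> 'b \<Rightarrow> real) \<Rightarrow>
     ('a \<Rightarrow> 'b) \<Rightarrow> bool" where
  "weakly_quasisymmetric \<nu> X d X' d' g \<longleftrightarrow>
     metric_embedding X d X' d' g \<and>
     (\<forall>a\<in>X. \<forall>x\<in>X. \<forall>y\<in>X. d a x \<le> d a y \<longrightarrow> d' (g a) (g x) \<le> \<nu> * d' (g a) (g y))"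

end

theory Submission
  imports Defs
begin

text \<open>Let \<open>\<delta>\<close>, \<open>\<delta>'\<close> be the internal metrics of \<open>D\<close> and \<open>D'\<close> (the latter evaluated at image points),
  \<open>\<delta> a x \<le> t * \<delta> a y\<close>, \<open>r = \<delta>' a y\<close> and \<open>R = \<delta>' a x\<close>. Only upper bounds of moduli are computed, and only
  the inequality \<open>Mod \<Gamma> \<le> K * Mod (f \<Gamma>)\<close> is needed.

  For large \<open>t\<close>, initial pieces \<open>C0\<close> (starting at \<open>a\<close>) and \<open>C1\<close> (starting at \<open>x\<close>) of arcs in \<open>A\<close> have
  diameters comparable to \<open>\<delta> a y\<close> and \<open>\<delta> a x\<close>. Weak quasisymmetry keeps \<open>f C0\<close> within \<open>\<delta>'\<close>-distance
  \<open>H * r\<close> of \<open>f a\<close> and \<open>f C1\<close> at \<open>\<delta>'\<close>-distance at least \<open>R / (1 + H)\<close>. Broadness bounds the modulus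
  below, the ring estimate bounds it above by a quantity tending to 0 as \<open>R / r\<close> grows.

  For small \<open>t\<close>, consider \<open>N\<close> scales \<open>d i\<close> between \<open>\<delta> a x\<close> and \<open>\<delta> a y\<close>, geometrically separated. At each of
  them broadness supplies a curve family of modulus bounded below, and by the ring estimate it may
  be confined to an annulus around \<open>a\<close>; these annuli are disjoint. The image curves have diameter at least
  \<open>\<delta>' a x / H\<^sup>2\<close> and start within \<open>H * \<delta>' a y\<close> of \<open>f a\<close>, so comparing the disjoint images of the annuli
  with the volume of a ball of radius \<open>2 * H * \<delta>' a y\<close> gives
  \<open>N * \<delta>' a x ^ n \<le> const * \<delta>' a y ^ n\<close>.\<close>

subsection \<open>Arc length\<close>

lemma curve_length_upper:
  assumes "t 0 = a" "t k = b" "\<And>i. i < k \<Longrightarrow> t i \<le> t (Suc i)"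
  shows "ennreal (\<Sum>i<k. dist (g (t i)) (g (t (Suc i)))) \<le> curve_length g a b"
  unfolding curve_length_def using assms by (intro SUP_upper2[of "(k, t)"]) auto

lemma curve_length_least:
  assumes "\<And>k t. \<lbrakk>t 0 = a; t k = b; \<And>i. i < k \<Longrightarrow> t i \<le> t (Suc i)\<rbrakk> \<Longrightarrow>
             ennreal (\<Sum>i<k. dist (g (t i)) (g (t (Suc i)))) \<le> L"
  shows "curve_length g a b \<le> L"
  unfolding curve_length_def by (intro SUP_least) (use assms in auto)

text \<open>An additive bound for the increments of \<open>g\<close>. Such a \<open>v\<close> exists
  exactly when the length is finite, so rectifiability can be transported between curves without
  handling partitions.\<close>

definition control :: "(real \<Rightarrow> 'a::metric_space) \<Rightarrow> real \<Rightarrow> real \<Rightarrow> (real \<Rightarrow> real) \<Rightarrow> bool" where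
  "control g a b v \<longleftrightarrow> (\<forall>s t. a \<le> s \<longrightarrow> s \<le> t \<longrightarrow> t \<le> b \<longrightarrow> dist (g s) (g t) \<le> v t - v s)"

lemma controlD: "\<lbrakk>control g a b v; a \<le> s; s \<le> t; t \<le> b\<rbrakk> \<Longrightarrow> dist (g s) (g t) \<le> v t - v s"
  by (auto simp: control_def)

lemma partition_mono:
  fixes t :: "nat \<Rightarrow> 'b::order"
  assumes "\<And>i. i < k \<Longrightarrow> t i \<le> t (Suc i)" "i \<le> j" "j \<le> k"
  shows "t i \<le> t j"
  using assms(2,3)
proof (induction j rule: dec_induct)
  case (step n)
  then show ?case using assms(1)[of n] by (meson Suc_leD less_le_trans order_trans lessI)
qed simp

lemma curve_length_le_control:
  assumes "control g a b v"
  shows "curve_length g a b \<le> ennreal (v b - v a)"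
proof (rule curve_length_least)
  fix k :: nat and t :: "nat \<Rightarrow> real"
  assume t: "t 0 = a" "t k = b" and mono: "\<And>i. i < k \<Longrightarrow> t i \<le> t (Suc i)"
  have "(\<Sum>i<k. dist (g (t i)) (g (t (Suc i)))) \<le> (\<Sum>i<k. v (t (Suc i)) - v (t i))"
  proof (rule sum_mono)
    fix i assume i: "i \<in> {..<k}"
    have "a \<le> t i" "t (Suc i) \<le> b"
      using partition_mono[of k t, OF mono] i t by (metis lessThan_iff less_imp_le le0, metis Suc_leI lessThan_iff le_refl)
    with i mono show "dist (g (t i)) (g (t (Suc i))) \<le> v (t (Suc i)) - v (t i)"
      by (intro controlD[OF assms]) auto
  qed
  also have "\<dots> = v b - v a"
    using sum_lessThan_telescope[of "\<lambda>i. v (t i)" k] t by simp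
  finally show "ennreal (\<Sum>i<k. dist (g (t i)) (g (t (Suc i)))) \<le> ennreal (v b - v a)"
    by (rule ennreal_leI)
qed

text \<open>A partition of \<open>{a..s}\<close> followed by the extra point \<open>t\<close> is a
  partition of \<open>{a..t}\<close>.\<close>

lemma curve_length_append:
  assumes "s \<le> t"
  shows "a \<le> s \<Longrightarrow> curve_length g a s + ennreal (dist (g s) (g t)) \<le> curve_length g a t"
proof -
  assume "a \<le> s"
  let ?I = "{(k::nat, u::nat \<Rightarrow> real). u 0 = a \<and> u k = s \<and> (\<forall>i<k. u i \<le> u (Suc i))}"
  have ne: "?I \<noteq> {}"
    using \<open>a \<le> s\<close> by (auto intro!: exI[of _ "Suc 0"] exI[of _ "\<lambda>i. if i = 0 then a else s"])
  have "curve_length g a s + ennreal (dist (g s) (g t)) =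
        (SUP (k, u) \<in> ?I. ennreal (\<Sum>i<k. dist (g (u i)) (g (u (Suc i)))) + ennreal (dist (g s) (g t)))"
    unfolding curve_length_def using ne
    by (subst ennreal_SUP_add_left[symmetric]) (auto simp: case_prod_unfold)
  also have "\<dots> \<le> curve_length g a t"
  proof (rule SUP_least, clarify)
    fix k and u :: "nat \<Rightarrow> real"
    assume u: "a = u 0" "s = u k" "\<forall>i<k. u i \<le> u (Suc i)"
    define w where "w = (\<lambda>i. if i \<le> k then u i else t)"
    have "ennreal (\<Sum>i<k. dist (g (u i)) (g (u (Suc i)))) + ennreal (dist (g (u k)) (g t)) =
          ennreal (\<Sum>i<Suc k. dist (g (w i)) (g (w (Suc i))))"
      by (simp add: w_def ennreal_plus[symmetric] sum_nonneg del: ennreal_plus)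
    also have "\<dots> \<le> curve_length g (u 0) t"
      using u assms by (intro curve_length_upper) (auto simp: w_def less_Suc_eq)
    finally show "ennreal (\<Sum>i<k. dist (g (u i)) (g (u (Suc i)))) + ennreal (dist (g (u k)) (g t))
       \<le> curve_length g (u 0) t" .
  qed
  finally show ?thesis .
qed

lemma curve_length_mono:
  assumes "a \<le> s" "s \<le> t"
  shows "curve_length g a s \<le> curve_length g a t"
  using curve_length_append[OF assms(2,1), of g] by (meson add_increasing2 le_zero_eq order_trans zero_le le_add_same_cancel1 add_left_mono order_refl)

text \<open>By \<open>curve_length_append\<close>, arc length is itself a control function; by
  \<open>curve_length_le_control\<close> no other one has a smaller total increment.\<close>

lemma control_curve_length:
  assumes fin: "curve_length g a b < \<infinity>"
  shows "control g a b (\<lambda>t. enn2real (curve_length g a t))"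
  unfolding control_def
proof (intro allI impI)
  fix s t assume st: "a \<le> s" "s \<le> t" "t \<le> b"
  have ft: "curve_length g a t < \<infinity>"
    using curve_length_mono[of a t b g] st fin by (meson le_less_trans order_trans)
  have fs: "curve_length g a s < \<infinity>"
    using curve_length_mono[of a s t g] st ft by (meson le_less_trans)
  have "enn2real (curve_length g a s + ennreal (dist (g s) (g t))) \<le> enn2real (curve_length g a t)"
    using curve_length_append[OF st(2,1)] ft by (intro enn2real_mono) auto
  then show "dist (g s) (g t) \<le> enn2real (curve_length g a t) - enn2real (curve_length g a s)"
    using fs by (simp add: enn2real_plus)
qed

lemma curve_length_self [simp]: "curve_length g a a = 0"
proof -
  have "control g a a (\<lambda>_. 0)" unfolding control_def
  proof (intro allI impI)
    fix s t assume "a \<le> s" "s \<le> t" "t \<le> a"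
    then have "s = t" by simp
    then show "dist (g s) (g t) \<le> 0 - 0" by simp
  qed
  from curve_length_le_control[OF this] show ?thesis by simp
qed

lemma curve_length_finite_iff:
  "curve_length g a b < \<infinity> \<longleftrightarrow> (\<exists>v. control g a b v)"
  using control_curve_length curve_length_le_control by (metis ennreal_less_top infinity_ennreal_def le_less_trans)

text \<open>If arc length jumped over the value \<open>s\<close>, lowering it after the jump would give a smaller
  control function.\<close>

lemma curve_length_attains:
  assumes cont: "continuous_on {a..b} g" and "a \<le> b" and fin: "curve_length g a b < \<infinity>"
    and s: "0 \<le> s" "s \<le> enn2real (curve_length g a b)"
  obtains t where "t \<in> {a..b}" "curve_length g a t = ennreal s"
proof -
  define v where "v = (\<lambda>t. enn2real (curve_length g a t))"
  have ctrl: "control g a b v" unfolding v_def by (rule control_curve_length[OF fin])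
  have vmono: "v x \<le> v y" if "a \<le> x" "x \<le> y" "y \<le> b" for x y
    using controlD[OF ctrl that] zero_le_dist[of "g x" "g y"] by linarith
  have fin': "curve_length g a t = ennreal (v t)" if "a \<le> t" "t \<le> b" for t
    unfolding v_def using curve_length_mono[of a t b g] that fin
    by (subst ennreal_enn2real) (auto intro: le_less_trans)
  have va: "v a = 0" by (simp add: v_def)
  have sb: "s \<le> v b" using s by (simp add: v_def)
  have "\<exists>t\<in>{a..b}. v t = s"
  proof (rule ccontr)
    assume no: "\<not> (\<exists>t\<in>{a..b}. v t = s)"
    \<comment> \<open>\<open>P\<close> collects the parameters before the supposed jump, and
      \<open>t0\<close> is the place of the jump.\<close>
    define P where "P = {t\<in>{a..b}. v t < s}"
    define t0 where "t0 = Sup P"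
    have aP: "a \<in> P" using no va s \<open>a \<le> b\<close> by (force simp: P_def)
    have bdd: "bdd_above P" by (auto simp: P_def intro: bdd_aboveI[of _ b])
    have t0: "t0 \<in> {a..b}"
      using aP bdd by (auto simp: t0_def P_def intro: cSup_upper2 cSup_least)
    have below: "v t < s" if "a \<le> t" "t < t0" for t
    proof -
      obtain p where "p \<in> P" "t < p" using \<open>t < t0\<close> less_cSupD[of P t] aP by (auto simp: t0_def)
      then show ?thesis using vmono[of t p] that by (auto simp: P_def)
    qed
    have above: "s < v t" if "t0 < t" "t \<le> b" for t
    proof -
      have "t \<notin> P" using that cSup_upper[OF _ bdd, of t] by (auto simp: t0_def)
      moreover have "t \<in> {a..b}" using that t0 by auto
      ultimately have "\<not> v t < s" "v t \<noteq> s" using no by (auto simp: P_def)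
      then show ?thesis by linarith
    qed
    \<comment> \<open>Whether \<open>t0\<close> belongs to \<open>P\<close> decides where the gap in
      the values of \<open>v\<close> lies: between \<open>v t0\<close> and \<open>s\<close>, or
      between \<open>s\<close> and \<open>v t0\<close>.\<close>
    obtain \<alpha> \<beta> where ab: "\<alpha> < \<beta>" and \<alpha>: "\<And>t. t \<in> P \<Longrightarrow> v t \<le> \<alpha>"
      and \<beta>: "\<And>t. t \<in> {a..b} - P \<Longrightarrow> \<beta> \<le> v t"
    proof (cases "t0 \<in> P")
      case True
      have "v t \<le> v t0" if "t \<in> P" for t
        using that t0 cSup_upper[OF that bdd] by (intro vmono) (auto simp: P_def t0_def)
      then show ?thesis using True by (intro that[of "v t0" s]) (auto simp: P_def)
    next
      case False
      have "v t0 \<le> v t" if "t \<in> {a..b} - P" for t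
      proof -
        have "\<not> t < t0" using below[of t] that by (auto simp: P_def)
        then show ?thesis using that t0 by (intro vmono) auto
      qed
      moreover have "s < v t0" using False t0 no by (force simp: P_def)
      ultimately show ?thesis by (intro that[of s "v t0"]) (auto simp: P_def)
    qed
    define w where "w = (\<lambda>t. if t \<in> P then v t else v t - (\<beta> - \<alpha>))"
    have "control g a b w"
      unfolding control_def
    proof (intro allI impI)
      fix p q assume pq: "a \<le> p" "p \<le> q" "q \<le> b"
      show "dist (g p) (g q) \<le> w q - w p"
      proof (cases "p \<in> P \<and> q \<notin> P")
        case False
        moreover have "p \<in> P" if "q \<in> P" using that pq vmono[of p q] by (auto simp: P_def)
        ultimately show ?thesis using controlD[OF ctrl pq] by (auto simp: w_def)
      next
        case True
        have pt: "p \<le> t0" using True cSup_upper[OF _ bdd] by (auto simp: t0_def)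
        have tq: "t0 \<le> q" using True below[of q] pq by (force simp: P_def)
        \<comment> \<open>Across the jump, insert \<open>p'\<close> in \<open>P\<close> and
          \<open>q'\<close> outside \<open>P\<close>, both near \<open>t0\<close>. By continuity
          \<open>g\<close> moves by at most \<open>e\<close> between them, while \<open>v\<close>
          gains at least \<open>\<beta> - \<alpha>\<close>; this gain can therefore be
          dropped.\<close>
        have "dist (g p) (g q) \<le> w q - w p + e" if "e > 0" for e
        proof -
          obtain d where "d > 0" and d: "\<And>x. x \<in> {a..b} \<Longrightarrow> dist x t0 < d \<Longrightarrow> dist (g x) (g t0) < e / 2"
            using cont t0 \<open>e > 0\<close> unfolding continuous_on_iff by (metis half_gt_zero)
          obtain p' where p': "p \<le> p'" "p' \<in> P" "p' \<le> t0" "dist p' t0 < d"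
          proof (cases "t0 \<in> P")
            case True then show ?thesis using pt \<open>d > 0\<close> by (intro that[of t0]) auto
          next
            case False
            then have "p < t0" using pt True by (metis order_le_less)
            then show ?thesis using below[of "max p (t0 - d/2)"] pq t0 \<open>d > 0\<close>
              by (intro that[of "max p (t0 - d/2)"]) (auto simp: P_def dist_real_def)
          qed
          obtain q' where q': "q' \<le> q" "q' \<in> {a..b} - P" "t0 \<le> q'" "dist q' t0 < d"
          proof (cases "t0 \<in> P")
            case False then show ?thesis using tq t0 \<open>d > 0\<close> by (intro that[of t0]) auto
          next
            case T: True
            then have "t0 < q" using tq True by (metis order_le_less)
            then show ?thesis using above[of "min q (t0 + d/2)"] pq t0 \<open>d > 0\<close>
              by (intro that[of "min q (t0 + d/2)"]) (auto simp: P_def dist_real_def)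
          qed
          have "dist (g p) (g q) \<le> dist (g p) (g p') + dist (g p') (g t0) + dist (g q') (g t0) + dist (g q') (g q)"
            using dist_triangle[of "g p" "g q" "g p'"] dist_triangle[of "g p'" "g q" "g t0"]
              dist_triangle[of "g t0" "g q" "g q'"] by (simp add: dist_commute)
          also have "\<dots> \<le> (v p' - v p) + e/2 + e/2 + (v q - v q')"
            using p' q' pq by (intro add_mono controlD[OF ctrl] less_imp_le[OF d]) (auto simp: P_def)
          also have "\<dots> \<le> w q - w p + e"
            using True \<alpha>[OF p'(2)] \<beta>[OF q'(2)] by (auto simp: w_def)
          finally show ?thesis .
        qed
        then show ?thesis by (rule field_le_epsilon)
      qed
    qed
    \<comment> \<open>The total increment of \<open>w\<close> falls short of the length
      \<open>v b\<close> by \<open>\<beta> - \<alpha>\<close>, which contradicts minimality of arc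
      length.\<close>
    from curve_length_le_control[OF this]
    have "ennreal (v b) \<le> ennreal (w b - w a)" using fin'[of b] \<open>a \<le> b\<close> by simp
    moreover have "b \<notin> P" using sb by (auto simp: P_def)
    then have "w b - w a < v b" "w b - w a = v b - (\<beta> - \<alpha>)" using aP va ab by (auto simp: w_def)
    moreover have "0 \<le> v b" by (simp add: v_def)
    moreover have "0 < v b" using \<open>b \<notin> P\<close> no \<open>a \<le> b\<close> s aP va
      by (metis P_def atLeastAtMost_iff mem_Collect_eq order_less_le_trans sb)
    ultimately show False by (simp add: ennreal_le_iff2)
  qed
  then show ?thesis using that fin' by auto
qed

lemma arclength_param_spec:
  assumes cont: "continuous_on {a..b} g" and "a \<le> b" and fin: "curve_length g a b < \<infinity>"
    and s: "0 \<le> s" "s \<le> enn2real (curve_length g a b)"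
  obtains t where "t \<in> {a..b}" "curve_length g a t = ennreal s" "arclength_param g a b s = g t"
proof -
  obtain t where "t \<in> {a..b} \<and> curve_length g a t = ennreal s"
    using curve_length_attains[OF assms] by blast
  then have "(SOME t. t \<in> {a..b} \<and> curve_length g a t = ennreal s) \<in> {a..b} \<and>
      curve_length g a (SOME t. t \<in> {a..b} \<and> curve_length g a t = ennreal s) = ennreal s"
    by (rule someI)
  then show ?thesis by (intro that[of "SOME t. t \<in> {a..b} \<and> curve_length g a t = ennreal s"])
     (auto simp: arclength_param_def)
qed

lemma arclength_param_lipschitz:
  assumes cont: "continuous_on {a..b} g" and "a \<le> b" and fin: "curve_length g a b < \<infinity>"
  shows "1-lipschitz_on {0..enn2real (curve_length g a b)} (arclength_param g a b)"
proof (rule lipschitz_on_leI)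
  fix s s' assume s: "s \<in> {0..enn2real (curve_length g a b)}" "s' \<in> {0..enn2real (curve_length g a b)}" "s \<le> s'"
  obtain t where t: "t \<in> {a..b}" "curve_length g a t = ennreal s" "arclength_param g a b s = g t"
    using arclength_param_spec[OF assms, of s] s by auto
  obtain t' where t': "t' \<in> {a..b}" "curve_length g a t' = ennreal s'" "arclength_param g a b s' = g t'"
    using arclength_param_spec[OF assms, of s'] s by auto
  define v where "v = (\<lambda>t. enn2real (curve_length g a t))"
  have v: "v t = s" "v t' = s'" using t t' s by (auto simp: v_def)
  have ctrl: "control g a b v" unfolding v_def by (rule control_curve_length[OF fin])
  show "dist (arclength_param g a b s) (arclength_param g a b s') \<le> 1 * dist s s'"
    using controlD[OF ctrl, of t t'] controlD[OF ctrl, of t' t] t t' v s(3) zero_le_dist[of "g t" "g t'"]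
    by (cases "t \<le> t'") (auto simp: dist_commute dist_real_def)
qed auto

lemma arclength_param_image:
  assumes cont: "continuous_on {a..b} g" and "a \<le> b" and fin: "curve_length g a b < \<infinity>"
  shows "arclength_param g a b ` {0..enn2real (curve_length g a b)} = g ` {a..b}"
proof (intro equalityI subsetI)
  fix x assume "x \<in> arclength_param g a b ` {0..enn2real (curve_length g a b)}"
  then show "x \<in> g ` {a..b}" using arclength_param_spec[OF assms] by force
next
  fix x assume "x \<in> g ` {a..b}"
  then obtain u where u: "u \<in> {a..b}" "x = g u" by auto
  define v where "v = (\<lambda>t. enn2real (curve_length g a t))"
  have ctrl: "control g a b v" unfolding v_def by (rule control_curve_length[OF fin])
  have "dist (g u) (g b) \<le> v b - v u" using controlD[OF ctrl, of u b] u by auto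
  then have "v u \<le> v b" using zero_le_dist[of "g u" "g b"] by linarith
  then have s: "0 \<le> v u" "v u \<le> enn2real (curve_length g a b)" by (auto simp: v_def)
  \<comment> \<open>The parameter chosen for the arc length \<open>v u\<close> may differ from
    \<open>u\<close>, but equal arc length forces \<open>g t = g u\<close>.\<close>
  obtain t where t: "t \<in> {a..b}" "curve_length g a t = ennreal (v u)" "arclength_param g a b (v u) = g t"
    using arclength_param_spec[OF assms s] by blast
  then have veq: "v t = v u" using s by (simp add: v_def)
  have "dist (g t) (g u) \<le> \<bar>v t - v u\<bar>"
    using controlD[OF ctrl, of t u] controlD[OF ctrl, of u t] t(1) u(1)
    by (cases "t \<le> u") (auto simp: dist_commute)
  then have "g t = g u" using veq by simp
  then have "x = arclength_param g a b (v u)" using t u by simp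
  then show "x \<in> arclength_param g a b ` {0..enn2real (curve_length g a b)}"
    using s by (intro image_eqI[of _ _ "v u"]) auto
qed

subsection \<open>Modulus estimates\<close>

lemma crossing_interval:
  fixes u :: "real \<Rightarrow> real"
  assumes cont: "continuous_on {p..q} u" and "p \<le> q" and ab: "\<alpha> < \<beta>" and "u p \<le> \<alpha>" "\<beta> \<le> u q"
  obtains s t where "p \<le> s" "s \<le> t" "t \<le> q" "u s = \<alpha>" "u t = \<beta>"
    "\<And>x. s < x \<Longrightarrow> x < t \<Longrightarrow> \<alpha> < u x \<and> u x < \<beta>"
proof -
  \<comment> \<open>\<open>t\<close> is the first time that \<open>u\<close> reaches
    \<open>\<beta>\<close>; below, \<open>s\<close> is the last time up to \<open>t\<close> at which
    \<open>u\<close> is at most \<open>\<alpha>\<close>.\<close>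
  define t where "t = Inf {x\<in>{p..q}. \<beta> \<le> u x}"
  have cl: "closed {x\<in>{p..q}. \<beta> \<le> u x}"
    using continuous_closed_preimage[OF cont, of "{\<beta>..}"] by (simp add: vimage_def Int_def)
  have T: "t \<in> {x\<in>{p..q}. \<beta> \<le> u x}" unfolding t_def
    using cl assms by (intro closed_contains_Inf) (auto intro: bdd_belowI[of _ p])
  have lowt: "u x < \<beta>" if "p \<le> x" "x < t" for x
  proof (rule ccontr)
    assume "\<not> u x < \<beta>"
    then have "x \<in> {x\<in>{p..q}. \<beta> \<le> u x}" using that T by auto
    then have "t \<le> x" unfolding t_def by (intro cInf_lower) (auto intro: bdd_belowI[of _ p])
    then show False using that by simp
  qed
  define s where "s = Sup {x\<in>{p..t}. u x \<le> \<alpha>}"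
  have contt: "continuous_on {p..t} u" using cont T by (auto intro: continuous_on_subset)
  have cl': "closed {x\<in>{p..t}. u x \<le> \<alpha>}"
    using continuous_closed_preimage[OF contt, of "{..\<alpha>}"] by (simp add: vimage_def Int_def)
  have S: "s \<in> {x\<in>{p..t}. u x \<le> \<alpha>}" unfolding s_def
    using cl' assms T by (intro closed_contains_Sup) (auto intro!: bdd_aboveI[of _ t])
  have ups: "\<alpha> < u x" if "s < x" "x \<le> t" for x
  proof (rule ccontr)
    assume "\<not> \<alpha> < u x"
    then have "x \<in> {x\<in>{p..t}. u x \<le> \<alpha>}" using that S by auto
    then have "x \<le> s" unfolding s_def by (intro cSup_upper) (auto intro: bdd_aboveI[of _ t])
    then show False using that by simp
  qed
  have ut: "u t = \<beta>"
  proof (rule antisym)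
    obtain y where "p \<le> y" "y \<le> t" "u y = \<beta>"
      using IVT'[of u p \<beta> t] contt T assms by auto
    then show "u t \<le> \<beta>" using lowt[of y] by (cases "y = t") auto
  qed (use T in auto)
  have us: "u s = \<alpha>"
  proof (rule antisym)
    obtain y where "s \<le> y" "y \<le> t" "u y = \<alpha>"
      using IVT'[of u s \<alpha> t] continuous_on_subset[OF contt, of "{s..t}"] S ut ab by auto
    then show "\<alpha> \<le> u s" using ups[of y] by (cases "y = s") auto
  qed (use S in auto)
  show ?thesis
    using S T us ut ups lowt by (intro that[of s t]) auto
qed

text \<open>A 1-Lipschitz function needs time at least \<open>\<beta> - \<alpha>\<close> to pass
  from \<open>\<alpha>\<close> to \<open>\<beta>\<close>. If \<open>p\<close> comes after
  \<open>q\<close>, time is reversed.\<close>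

lemma lipschitz_crossing_time:
  fixes u :: "real \<Rightarrow> real"
  assumes lip: "1-lipschitz_on {0..L} u" and pq: "p \<in> {0..L}" "q \<in> {0..L}"
    and ab: "\<alpha> < \<beta>" and u: "u p \<le> \<alpha>" "\<beta> \<le> u q"
    and S: "\<And>s. s \<in> {0..L} \<Longrightarrow> \<alpha> < u s \<Longrightarrow> u s < \<beta> \<Longrightarrow> P s"
  obtains s t where "0 \<le> s" "s \<le> t" "t \<le> L" "\<beta> - \<alpha> \<le> t - s" "\<And>x. x \<in> {s<..<t} \<Longrightarrow> P x"
proof -
  have cont: "continuous_on {0..L} u" by (rule lipschitz_on_continuous_on[OF lip])
  have len: "\<beta> - \<alpha> \<le> \<bar>t - s\<bar>" if "s \<in> {0..L}" "t \<in> {0..L}" "u s = \<alpha>" "u t = \<beta>" for s t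
    using lipschitz_onD[OF lip that(1,2)] that ab by (auto simp: dist_real_def abs_if split: if_splits)
  show ?thesis
  proof (cases "p \<le> q")
    case True
    obtain s t where st: "p \<le> s" "s \<le> t" "t \<le> q" "u s = \<alpha>" "u t = \<beta>"
      "\<And>x. s < x \<Longrightarrow> x < t \<Longrightarrow> \<alpha> < u x \<and> u x < \<beta>"
      using crossing_interval[OF continuous_on_subset[OF cont] True ab u] pq by auto
    then show ?thesis using len[of s t] pq by (intro that[of s t]) (auto intro: S)
  next
    case False
    have "continuous_on {-p..-q} (\<lambda>x. u (-x))"
      using pq by (intro continuous_on_compose2[OF cont] continuous_intros) auto
    then obtain s t where st: "-p \<le> s" "s \<le> t" "t \<le> -q" "u (-s) = \<alpha>" "u (-t) = \<beta>"
      "\<And>x. s < x \<Longrightarrow> x < t \<Longrightarrow> \<alpha> < u (-x) \<and> u (-x) < \<beta>"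
      using crossing_interval[of "-p" "-q" "\<lambda>x. u (-x)" \<alpha> \<beta>] u ab False by auto
    have *: "\<alpha> < u x \<and> u x < \<beta>" if "-t < x" "x < -s" for x using st(6)[of "-x"] that by auto
    show ?thesis using st len[of "-s" "-t"] pq
      by (intro that[of "-t" "-s"]) (auto intro!: S dest: *)
  qed
qed

text \<open>Along the arc length parametrization the distance to \<open>z\<close> is 1-Lipschitz, so
  the curve spends length at least \<open>\<beta> k - \<alpha> k\<close> in each shell. This serves
  both the family of dyadic rings and a single ball.\<close>

lemma line_integral_ge_sum:
  fixes g :: "real \<Rightarrow> 'a::euclidean_space" and c :: "'k \<Rightarrow> ennreal"
  assumes cont: "continuous_on {a..b} g" and "a \<le> b" and fin: "curve_length g a b < \<infinity>"
    and p: "p \<in> g ` {a..b}" and q: "q \<in> g ` {a..b}" and I: "finite I"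
    and \<alpha>: "\<And>k. k \<in> I \<Longrightarrow> dist z p \<le> \<alpha> k" and \<beta>: "\<And>k. k \<in> I \<Longrightarrow> \<beta> k \<le> dist z q"
    and ab: "\<And>k. k \<in> I \<Longrightarrow> \<alpha> k < \<beta> k"
    and S: "\<And>k x. \<lbrakk>k \<in> I; x \<in> g ` {a..b}; \<alpha> k < dist z x; dist z x < \<beta> k\<rbrakk> \<Longrightarrow> x \<in> S k"
    and \<rho>: "\<And>x. (\<Sum>k\<in>I. c k * indicator (S k) x) \<le> \<rho> x"
  shows "(\<Sum>k\<in>I. c k * ennreal (\<beta> k - \<alpha> k)) \<le> line_integral \<rho> ({a..b}, g)"
proof -
  define L where "L = enn2real (curve_length g a b)"
  let ?h = "arclength_param g a b"
  have im: "?h ` {0..L} = g ` {a..b}"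
    unfolding L_def by (rule arclength_param_image[OF assms(1-3)])
  have lip: "1-lipschitz_on {0..L} (\<lambda>s. dist z (?h s))"
  proof (rule lipschitz_onI)
    fix s t assume "s \<in> {0..L}" "t \<in> {0..L}"
    then have "dist (?h s) (?h t) \<le> 1 * dist s t"
      using lipschitz_onD[OF arclength_param_lipschitz[OF assms(1-3), folded L_def]] by blast
    moreover have "dist (dist z (?h s)) (dist z (?h t)) \<le> dist (?h s) (?h t)"
      using dist_triangle[of z "?h s" "?h t"] dist_triangle[of z "?h t" "?h s"]
      by (simp add: dist_real_def dist_commute abs_le_iff)
    ultimately show "dist (dist z (?h s)) (dist z (?h t)) \<le> 1 * dist s t" by linarith
  qed auto
  obtain p' q' where pq: "p' \<in> {0..L}" "q' \<in> {0..L}" "?h p' = p" "?h q' = q"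
    using p q im by (metis imageE)
  have "\<exists>s t. 0 \<le> s \<and> s \<le> t \<and> t \<le> L \<and> \<beta> k - \<alpha> k \<le> t - s \<and> (\<forall>x\<in>{s<..<t}. ?h x \<in> S k)" if k: "k \<in> I" for k
  proof -
    have 1: "dist z (?h p') \<le> \<alpha> k" "\<beta> k \<le> dist z (?h q')" using \<alpha>[OF k] \<beta>[OF k] pq by auto
    have 2: "?h s \<in> S k" if "s \<in> {0..L}" "\<alpha> k < dist z (?h s)" "dist z (?h s) < \<beta> k" for s
      using that im k by (intro S) auto
    show ?thesis
      by (rule lipschitz_crossing_time[OF lip pq(1,2) ab[OF k] 1, of "\<lambda>s. ?h s \<in> S k"])
         (use 2 in blast)+
  qed
  then obtain s t where st: "\<And>k. k \<in> I \<Longrightarrow> 0 \<le> s k \<and> s k \<le> t k \<and> t k \<le> L \<and> \<beta> k - \<alpha> k \<le> t k - s k \<and>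
      (\<forall>x\<in>{s k<..<t k}. ?h x \<in> S k)"
    by metis
  have "(\<Sum>k\<in>I. c k * ennreal (\<beta> k - \<alpha> k)) \<le> (\<Sum>k\<in>I. c k * ennreal (t k - s k))"
    using st by (intro sum_mono mult_left_mono ennreal_leI) auto
  also have "\<dots> = (\<integral>\<^sup>+ x. (\<Sum>k\<in>I. c k * indicator {s k<..<t k} x) \<partial>lborel)"
    using st I by (subst nn_integral_sum) (auto simp: nn_integral_cmult intro!: sum.cong)
  also have "\<dots> \<le> (\<integral>\<^sup>+ x \<in> {0..L}. \<rho> (?h x) \<partial>lborel)"
  proof (intro nn_integral_mono)
    fix x
    show "(\<Sum>k\<in>I. c k * indicator {s k<..<t k} x) \<le> \<rho> (?h x) * indicator {0..L} x"
    proof (cases "x \<in> {0..L}")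
      case True
      have "(\<Sum>k\<in>I. c k * indicator {s k<..<t k} x) \<le> (\<Sum>k\<in>I. c k * indicator (S k) (?h x))"
        using st by (intro sum_mono mult_left_mono) (auto simp: indicator_def)
      then show ?thesis using \<rho>[of "?h x"] True by simp
    next
      case False
      have "(\<Sum>k\<in>I. c k * indicator {s k<..<t k} x) = 0"
      proof (rule sum.neutral, rule ballI)
        fix k assume "k \<in> I"
        then show "c k * indicator {s k<..<t k} x = 0"
          using st[of k] False by (auto simp: indicator_def)
      qed
      then show ?thesis by simp
    qed
  qed
  also have "\<dots> = line_integral_on \<rho> g a b" by (simp add: line_integral_on_def L_def)
  also have "\<dots> \<le> line_integral \<rho> ({a..b}, g)"
    unfolding line_integral_def using \<open>a \<le> b\<close> by (auto intro!: SUP_upper2[of "(a, b)"])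
  finally show ?thesis .
qed

section \<open>Monotonicity and subadditivity of the modulus\<close>

lemma modulus_le: "admissible \<Gamma> \<rho> \<Longrightarrow> modulus \<Gamma> \<le> (\<integral>\<^sup>+ x. \<rho> x ^ DIM('a) \<partial>lborel)"
  for \<rho> :: "'a::euclidean_space \<Rightarrow> ennreal"
  unfolding modulus_def by (intro INF_lower) auto

lemma line_integral_mono:
  assumes "\<And>x. \<rho> x \<le> \<sigma> x"
  shows "line_integral \<rho> c \<le> line_integral \<sigma> c"
  unfolding line_integral_def line_integral_on_def case_prod_unfold
  by (intro SUP_mono' nn_integral_mono mult_right_mono assms) auto

lemma modulus_mono: "\<Gamma> \<subseteq> \<Delta> \<Longrightarrow> modulus \<Gamma> \<le> modulus \<Delta>"
  unfolding modulus_def admissible_def by (intro INF_superset_mono) auto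

text \<open>The pointwise maximum of weights admissible for the two families is admissible for the
  union, and its power is at most the sum of the two powers.\<close>

lemma modulus_Un_le:
  fixes \<Gamma> \<Delta> :: "'a::euclidean_space curve set"
  shows "modulus (\<Gamma> \<union> \<Delta>) \<le> modulus \<Gamma> + modulus \<Delta>"
proof -
  have 1: "modulus (\<Gamma> \<union> \<Delta>) \<le> (\<integral>\<^sup>+ x. \<rho> x ^ DIM('a) \<partial>lborel) + (\<integral>\<^sup>+ x. \<sigma> x ^ DIM('a) \<partial>lborel)"
    if \<rho>: "admissible \<Gamma> \<rho>" and \<sigma>: "admissible \<Delta> \<sigma>" for \<rho> \<sigma>
  proof -
    have m[measurable]: "\<rho> \<in> borel_measurable borel" "\<sigma> \<in> borel_measurable borel"
      using \<rho> \<sigma> by (auto simp: admissible_def)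
    have "admissible (\<Gamma> \<union> \<Delta>) (\<lambda>x. max (\<rho> x) (\<sigma> x))"
      unfolding admissible_def
    proof (intro conjI ballI impI)
      fix c assume c: "c \<in> \<Gamma> \<union> \<Delta>" "locally_rectifiable c"
      then have "1 \<le> line_integral \<rho> c \<or> 1 \<le> line_integral \<sigma> c" using \<rho> \<sigma> by (auto simp: admissible_def)
      moreover have "line_integral \<rho> c \<le> line_integral (\<lambda>x. max (\<rho> x) (\<sigma> x)) c"
        "line_integral \<sigma> c \<le> line_integral (\<lambda>x. max (\<rho> x) (\<sigma> x)) c"
        by (auto intro!: line_integral_mono)
      ultimately show "1 \<le> line_integral (\<lambda>x. max (\<rho> x) (\<sigma> x)) c" by (meson order_trans)
    qed measurable
    then have "modulus (\<Gamma> \<union> \<Delta>) \<le> (\<integral>\<^sup>+ x. max (\<rho> x) (\<sigma> x) ^ DIM('a) \<partial>lborel)" by (rule modulus_le)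
    also have "\<dots> \<le> (\<integral>\<^sup>+ x. \<rho> x ^ DIM('a) + \<sigma> x ^ DIM('a) \<partial>lborel)"
      by (intro nn_integral_mono) (auto simp: max_def)
    also have "\<dots> = (\<integral>\<^sup>+ x. \<rho> x ^ DIM('a) \<partial>lborel) + (\<integral>\<^sup>+ x. \<sigma> x ^ DIM('a) \<partial>lborel)"
      by (intro nn_integral_add) auto
    finally show ?thesis .
  qed
  \<comment> \<open>This moves an infimum out of a sum, by subtracting the finite summand
    \<open>y\<close>. It is applied first to the weights for \<open>\<Gamma>\<close>, then to those
    for \<open>\<Delta>\<close>.\<close>
  have 2: "x \<le> (INF i\<in>I. f i) + y" if "\<And>i. i \<in> I \<Longrightarrow> x \<le> f i + y" for x y :: ennreal and f :: "'i \<Rightarrow> ennreal" and I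
  proof (cases "y = top")
    case False
    have "x - y \<le> (INF i\<in>I. f i)"
      using that False by (intro INF_greatest) (auto simp: ennreal_minus_le_iff add.commute)
    then show ?thesis using False by (auto simp: ennreal_minus_le_iff add.commute)
  qed auto
  have "modulus (\<Gamma> \<union> \<Delta>) \<le> modulus \<Gamma> + (\<integral>\<^sup>+ x. \<sigma> x ^ DIM('a) \<partial>lborel)" if "admissible \<Delta> \<sigma>" for \<sigma>
    unfolding modulus_def[of \<Gamma>] using 1 that by (intro 2) auto
  then have "modulus (\<Gamma> \<union> \<Delta>) \<le> modulus \<Delta> + modulus \<Gamma>"
    unfolding modulus_def[of \<Delta>] by (intro 2) (auto simp: add.commute)
  then show ?thesis by (simp add: add.commute)
qed

text \<open>The energy of the weight \<open>1 / (N * s * 2 ^ k)\<close> on the dyadic rings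
  \<open>s * 2 ^ k < dist z x < s * 2 ^ (k + 1)\<close> for \<open>k < N\<close>, with the rings enlarged to balls.\<close>

definition ring_bound :: "nat \<Rightarrow> nat \<Rightarrow> real" where
  "ring_bound n N = unit_ball_vol (real n) * 2 ^ n * real N / real N ^ n"

lemma ring_bound_nonneg: "0 \<le> ring_bound n N"
  by (simp add: ring_bound_def)

text \<open>Here dimension at least 2 enters: \<open>N ^ n\<close> dominates \<open>N * N\<close>,
  so the bound decays at least like \<open>c / N\<close>.\<close>

lemma ring_bound_small:
  assumes "2 \<le> n" "0 < e"
  obtains N where "0 < N" "ring_bound n N < e"
proof -
  define c where "c = unit_ball_vol (real n) * 2 ^ n"
  obtain N :: nat where N: "c / e < real N" using reals_Archimedean2 by blast
  have c: "0 < c" by (simp add: c_def)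
  have Npos: "0 < N" using N c \<open>0 < e\<close> by (cases N) (auto simp: divide_less_0_iff)
  have "real N * real N \<le> real N ^ n"
    using power_increasing[of 2 n "real N"] assms Npos by (simp add: power2_eq_square)
  then have "ring_bound n N \<le> c * real N / (real N * real N)"
    using Npos c unfolding ring_bound_def c_def[symmetric] by (intro divide_left_mono) auto
  also have "\<dots> < e" using N Npos \<open>0 < e\<close> by (simp add: field_simps)
  finally show ?thesis using Npos that by blast
qed

text \<open>Every curve crosses all \<open>N\<close> dyadic rings and collects \<open>1 / N\<close>
  in each. The total energy is \<open>N\<close> times that of one ring, which is of order
  \<open>1 / N ^ n\<close>.\<close>

lemma modulus_ring:
  fixes \<Gamma> :: "'a::euclidean_space curve set"
  assumes "0 < s" "0 < N"
    and \<Gamma>: "\<And>c. c \<in> \<Gamma> \<Longrightarrow> \<exists>a b g p q. c = ({a..b}, g) \<and> a \<le> b \<and> continuous_on {a..b} g \<and>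
      p \<in> g ` {a..b} \<and> q \<in> g ` {a..b} \<and> dist z p \<le> s \<and> s * 2 ^ N \<le> dist z q"
  shows "modulus \<Gamma> \<le> ennreal (ring_bound DIM('a) N)"
proof -
  define A where "A = (\<lambda>k::nat. {x::'a. s * 2 ^ k < dist z x \<and> dist z x < s * 2 ^ Suc k})"
  define c where "c = (\<lambda>k::nat. 1 / (real N * (s * 2 ^ k)))"
  define \<rho> where "\<rho> = (\<lambda>x. \<Sum>k<N. ennreal (c k) * indicator (A k) x)"
  have [measurable]: "A k \<in> sets borel" for k unfolding A_def by measurable
  have disj: "j = k" if "x \<in> A j" "x \<in> A k" for x j k
  proof (rule ccontr)
    assume "j \<noteq> k"
    have *: False if "x \<in> A j" "x \<in> A k" "j < k" for j k
    proof -
      have "s * 2 ^ Suc j \<le> s * 2 ^ k"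
        using that \<open>0 < s\<close> by (intro mult_left_mono power_increasing) auto
      then show False using that by (auto simp: A_def)
    qed
    show False using *[of j k] *[of k j] that \<open>j \<noteq> k\<close> by (meson linorder_neqE_nat)
  qed
  have cpos: "0 < c k" for k using assms by (simp add: c_def)
  have "admissible \<Gamma> \<rho>"
    unfolding admissible_def
  proof (intro conjI ballI impI)
    show "\<rho> \<in> borel_measurable borel" unfolding \<rho>_def by measurable
    fix c' assume c': "c' \<in> \<Gamma>" "locally_rectifiable c'"
    obtain a b g p q where c: "c' = ({a..b}, g)" "a \<le> b" "continuous_on {a..b} g" "p \<in> g ` {a..b}"
      "q \<in> g ` {a..b}" "dist z p \<le> s" "s * 2 ^ N \<le> dist z q"
      using \<Gamma>[OF c'(1)] by blast
    have fin: "curve_length g a b < \<infinity>" using c' c by (auto simp: locally_rectifiable_def)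
    have "(\<Sum>k\<in>{..<N}. ennreal (c k) * ennreal (s * 2 ^ Suc k - s * 2 ^ k)) \<le> line_integral \<rho> ({a..b}, g)"
    proof (rule line_integral_ge_sum[OF c(3,2) fin c(4,5), where z = z and S = A])
      fix k assume k: "k \<in> {..<N}"
      have "s * 1 \<le> s * 2 ^ k" using \<open>0 < s\<close> by (intro mult_left_mono) auto
      then show "dist z p \<le> s * 2 ^ k" using c by simp
      have "s * 2 ^ Suc k \<le> s * 2 ^ N" using k \<open>0 < s\<close> by (intro mult_left_mono power_increasing) auto
      then show "s * 2 ^ Suc k \<le> dist z q" using c by simp
      show "s * 2 ^ k < s * 2 ^ Suc k" using \<open>0 < s\<close> by simp
    qed (auto simp: A_def \<rho>_def)
    also have "(\<Sum>k\<in>{..<N}. ennreal (c k) * ennreal (s * 2 ^ Suc k - s * 2 ^ k)) = (\<Sum>k\<in>{..<N}. ennreal (1 / real N))"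
      using cpos[THEN less_imp_le] \<open>0 < s\<close> \<open>0 < N\<close>
      by (intro sum.cong refl) (simp add: ennreal_mult[symmetric] c_def)
    also have "\<dots> = 1" using \<open>0 < N\<close>
      by (simp add: ennreal_of_nat_eq_real_of_nat ennreal_mult[symmetric] del: ennreal_1)
    finally show "1 \<le> line_integral \<rho> c'" using c by simp
  qed
  then have "modulus \<Gamma> \<le> (\<integral>\<^sup>+ x. \<rho> x ^ DIM('a) \<partial>lborel)" by (rule modulus_le)
  \<comment> \<open>The rings are disjoint, so at each point at most one summand is nonzero and the
    power passes into the sum.\<close>
  also have "\<dots> = (\<integral>\<^sup>+ x. (\<Sum>k<N. ennreal (c k ^ DIM('a)) * indicator (A k) x) \<partial>lborel)"
  proof (intro nn_integral_cong)
    fix x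
    show "\<rho> x ^ DIM('a) = (\<Sum>k<N. ennreal (c k ^ DIM('a)) * indicator (A k) x)"
    proof (cases "\<exists>j<N. x \<in> A j")
      case True
      then obtain j where j: "j < N" "x \<in> A j" by blast
      have "(\<Sum>k<N. f k * indicator (A k) x) = f j" for f :: "nat \<Rightarrow> ennreal"
      proof -
        have "(\<Sum>k<N. f k * indicator (A k) x) = (\<Sum>k<N. if k = j then f j else 0)"
        proof (intro sum.cong refl)
          show "f k * indicator (A k) x = (if k = j then f j else 0)" for k
            using disj[OF j(2), of k] j(2) by (cases "x \<in> A k") auto
        qed
        also have "\<dots> = f j" using j(1) by simp
        finally show ?thesis .
      qed
      then show ?thesis using cpos[of j] by (simp add: \<rho>_def ennreal_power less_imp_le)
    next
      case False
      then have "\<rho> x = 0" "(\<Sum>k<N. ennreal (c k ^ DIM('a)) * indicator (A k) x) = 0" by (auto simp: \<rho>_def)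
      then show ?thesis by simp
    qed
  qed
  also have "\<dots> = (\<Sum>k<N. ennreal (c k ^ DIM('a)) * emeasure lborel (A k))"
    by (subst nn_integral_sum) (auto simp: nn_integral_cmult)
  also have "\<dots> \<le> (\<Sum>k<N. ennreal (unit_ball_vol (real DIM('a)) * 2 ^ DIM('a) / real N ^ DIM('a)))"
  proof (rule sum_mono)
    fix k assume "k \<in> {..<N}"
    have "emeasure lborel (A k) \<le> emeasure lborel (ball z (s * 2 ^ Suc k))"
      by (intro emeasure_mono) (auto simp: A_def)
    also have "\<dots> = ennreal (unit_ball_vol (real DIM('a)) * (s * 2 ^ Suc k) ^ DIM('a))"
      using \<open>0 < s\<close> by (intro emeasure_ball) auto
    finally have "ennreal (c k ^ DIM('a)) * emeasure lborel (A k) \<le>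
       ennreal (c k ^ DIM('a)) * ennreal (unit_ball_vol (real DIM('a)) * (s * 2 ^ Suc k) ^ DIM('a))"
      by (intro mult_left_mono) auto
    also have "\<dots> = ennreal (unit_ball_vol (real DIM('a)) * (c k * (s * 2 ^ Suc k)) ^ DIM('a))"
      using cpos[of k] \<open>0 < s\<close> by (simp add: ennreal_mult[symmetric] power_mult_distrib mult_ac)
    \<comment> \<open>The radius cancels against the weight, so all rings have the same energy
      bound.\<close>
    also have "c k * (s * 2 ^ Suc k) = 2 / real N" using assms by (simp add: c_def)
    finally show "ennreal (c k ^ DIM('a)) * emeasure lborel (A k) \<le>
       ennreal (unit_ball_vol (real DIM('a)) * 2 ^ DIM('a) / real N ^ DIM('a))"
      by (simp add: power_divide)
  qed
  also have "\<dots> = ennreal (ring_bound DIM('a) N)"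
    by (simp add: ring_bound_def ennreal_of_nat_eq_real_of_nat ennreal_mult[symmetric] mult_ac)
  finally show ?thesis .
qed

subsection \<open>The internal metric\<close>

text \<open>The competitors in the infimum defining \<open>internal_dist\<close>. Injectivity of an
  arc forces distinct endpoints, which is why coinciding points are treated separately
  below.\<close>

definition rectifiable_arc :: "'a::euclidean_space set \<Rightarrow> 'a \<Rightarrow> 'a \<Rightarrow> (real \<Rightarrow> 'a) \<Rightarrow> bool" where
  "rectifiable_arc D x y g \<longleftrightarrow> arc g \<and> curve_length g 0 1 < \<infinity> \<and> path_image g \<subseteq> D \<and>
     pathstart g = x \<and> pathfinish g = y"

lemma rectifiable_arc_subpath:
  assumes g: "rectifiable_arc D x y g" and "0 \<le> u" "u < v" "v \<le> 1"
  shows "rectifiable_arc D (g u) (g v) (subpath u v g)"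
proof -
  obtain m where m: "control g 0 1 m"
    using g unfolding rectifiable_arc_def curve_length_finite_iff by blast
  have "control (subpath u v g) 0 1 (\<lambda>t. m ((v - u) * t + u))"
    unfolding control_def subpath_def
  proof (intro allI impI controlD[OF m])
    fix s t :: real assume st: "0 \<le> s" "s \<le> t" "t \<le> 1"
    show "0 \<le> (v - u) * s + u" using st assms by simp
    show "(v - u) * s + u \<le> (v - u) * t + u" using st assms by (simp add: mult_left_mono)
    have "(v - u) * t \<le> (v - u) * 1" using st assms by (intro mult_left_mono) auto
    then show "(v - u) * t + u \<le> 1" using assms(4) by (simp add: algebra_simps)
  qed
  moreover have "path_image (subpath u v g) \<subseteq> path_image g"
    using assms by (intro path_image_subpath_subset) auto
  ultimately show ?thesis
    using assms arc_subpath_arc[of g u v] unfolding rectifiable_arc_def curve_length_finite_iff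
    by auto
qed

lemma rectifiable_arc_reverse:
  assumes g: "rectifiable_arc D x y g"
  shows "rectifiable_arc D y x (reversepath g)"
proof -
  obtain m where m: "control g 0 1 m"
    using g unfolding rectifiable_arc_def curve_length_finite_iff by blast
  have "control (reversepath g) 0 1 (\<lambda>t. - m (1 - t))"
    unfolding control_def reversepath_def
  proof (intro allI impI)
    fix s t :: real assume st: "0 \<le> s" "s \<le> t" "t \<le> 1"
    then show "dist (g (1 - s)) (g (1 - t)) \<le> - m (1 - t) - - m (1 - s)"
      using controlD[OF m, of "1 - t" "1 - s"] by (simp add: dist_commute)
  qed
  then show ?thesis using g unfolding rectifiable_arc_def curve_length_finite_iff
    by (auto simp: arc_reversepath)
qed

lemma control_joinpaths:
  assumes g: "control g 0 1 m" and h: "control h 0 1 l" and gh: "pathfinish g = pathstart h"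
  shows "control (g +++ h) 0 1 (\<lambda>t. if t \<le> 1/2 then m (2 * t) else m 1 + l (2 * t - 1) - l 0)"
  unfolding control_def
proof (intro allI impI)
  fix s t :: real assume st: "0 \<le> s" "s \<le> t" "t \<le> 1"
  consider "t \<le> 1/2" | "s \<le> 1/2" "1/2 < t" | "1/2 < s" using st by linarith
  then show "dist ((g +++ h) s) ((g +++ h) t) \<le>
     (if t \<le> 1/2 then m (2 * t) else m 1 + l (2 * t - 1) - l 0) -
     (if s \<le> 1/2 then m (2 * s) else m 1 + l (2 * s - 1) - l 0)"
  proof cases
    case 1
    then show ?thesis using st controlD[OF g, of "2 * s" "2 * t"] by (simp add: joinpaths_def)
  next
    case 2
    have "dist (g (2 * s)) (h (2 * t - 1)) \<le> dist (g (2 * s)) (g 1) + dist (h 0) (h (2 * t - 1))"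
      using dist_triangle[of "g (2 * s)" "h (2 * t - 1)" "g 1"] gh
      by (simp add: pathfinish_def pathstart_def)
    then show ?thesis
      using 2 st controlD[OF g, of "2 * s" 1] controlD[OF h, of 0 "2 * t - 1"]
      by (simp add: joinpaths_def)
  next
    case 3
    then show ?thesis using st controlD[OF h, of "2 * s - 1" "2 * t - 1"] by (simp add: joinpaths_def)
  qed
qed

text \<open>The first arc is followed up to the point where the second one leaves it for the last time.\<close>

lemma rectifiable_arc_join:
  assumes g: "rectifiable_arc D x y g" and h: "rectifiable_arc D y z h" and "x \<noteq> z"
  obtains k where "rectifiable_arc D x z k" "path_image k \<subseteq> path_image g \<union> path_image h"
proof -
  have ag: "arc g" and ah: "arc h" and ends: "pathstart g = x" "pathfinish g = y" "pathstart h = y" "pathfinish h = z"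
    using g h by (auto simp: rectifiable_arc_def)
  have ch: "continuous_on {0..1} h" using ah by (simp add: arc_def path_def)
  have clg: "closed (path_image g)" using ag by (simp add: closed_path_image arc_imp_path)
  define T where "T = {0..1} \<inter> h -` path_image g"
  have "compact T"
    using continuous_closed_preimage[OF ch _ clg] by (auto simp: T_def compact_eq_bounded_closed intro: bounded_subset[of "{0..1}"])
  moreover have "0 \<in> T" using ends by (auto simp: T_def pathstart_def pathfinish_def path_image_def)
  ultimately obtain u where u: "u \<in> T" and umax: "\<And>t. t \<in> T \<Longrightarrow> t \<le> u"
    using compact_attains_sup[of T] by blast
  obtain v where v: "v \<in> {0..1}" "h u = g v" using u by (auto simp: T_def path_image_def)
  have u01: "0 \<le> u" "u \<le> 1" using u by (auto simp: T_def)
  have gsub: "path_image (subpath 0 v g) \<subseteq> path_image g"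
    using v by (intro path_image_subpath_subset) auto
  have hsub: "path_image (subpath u 1 h) \<subseteq> path_image h"
    using u01 by (intro path_image_subpath_subset) auto
  \<comment> \<open>For \<open>u = 1\<close> or \<open>v = 0\<close> one of the two pieces shrinks
    to a point, and the other one alone joins \<open>x\<close> to \<open>z\<close>.\<close>
  consider "u = 1" | "u < 1" "v = 0" | "u < 1" "0 < v" using u01 v by fastforce
  then show ?thesis
  proof cases
    case 1
    then have "g v = z" using v ends by (simp add: pathfinish_def)
    moreover from this have "0 < v" using ends \<open>x \<noteq> z\<close> v by (cases "v = 0") (auto simp: pathstart_def)
    ultimately show ?thesis using rectifiable_arc_subpath[OF g, of 0 v] v ends gsub
      by (intro that[of "subpath 0 v g"]) (auto simp: pathstart_def)
  next
    case 2
    then show ?thesis using rectifiable_arc_subpath[OF h, of u 1] v ends hsub u01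
      by (intro that[of "subpath u 1 h"]) (auto simp: pathstart_def pathfinish_def)
  next
    case 3
    have 1: "rectifiable_arc D x (g v) (subpath 0 v g)"
      using rectifiable_arc_subpath[OF g, of 0 v] 3 v ends by (auto simp: pathstart_def)
    have 2: "rectifiable_arc D (g v) z (subpath u 1 h)"
      using rectifiable_arc_subpath[OF h, of u 1] 3 v u01 ends by (auto simp: pathfinish_def)
    \<comment> \<open>Maximality of \<open>u\<close> in \<open>T\<close> means that the rest of
      \<open>h\<close> meets \<open>g\<close> only at its starting point.\<close>
    have "path_image (subpath 0 v g) \<inter> path_image (subpath u 1 h) \<subseteq> {g v}"
    proof
      fix w assume w: "w \<in> path_image (subpath 0 v g) \<inter> path_image (subpath u 1 h)"
      then obtain t where t: "u \<le> t" "t \<le> 1" "w = h t" using u01 by (auto simp: path_image_subpath)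
      have "t \<in> T" using w gsub t u01 by (auto simp: T_def)
      then have "t = u" using umax[of t] t by simp
      then show "w \<in> {g v}" using t v by simp
    qed
    then have "arc (subpath 0 v g +++ subpath u 1 h)"
      using 1 2 by (intro arc_join) (auto simp: rectifiable_arc_def)
    moreover have "curve_length (subpath 0 v g +++ subpath u 1 h) 0 1 < \<infinity>"
    proof -
      obtain m l where "control (subpath 0 v g) 0 1 m" "control (subpath u 1 h) 0 1 l"
        using 1 2 unfolding rectifiable_arc_def curve_length_finite_iff by blast
      moreover have "pathfinish (subpath 0 v g) = pathstart (subpath u 1 h)"
        using 1 2 by (simp add: rectifiable_arc_def)
      ultimately show ?thesis using control_joinpaths curve_length_finite_iff by blast
    qed
    moreover have "path_image (subpath 0 v g +++ subpath u 1 h) = path_image (subpath 0 v g) \<union> path_image (subpath u 1 h)"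
      using 1 2 by (intro path_image_join) (auto simp: rectifiable_arc_def)
    ultimately show ?thesis using 1 2 gsub hsub
      by (intro that[of "subpath 0 v g +++ subpath u 1 h"]) (auto simp: rectifiable_arc_def)
  qed
qed

lemma rectifiable_arc_linepath:
  assumes "x \<noteq> y" "closed_segment x y \<subseteq> D"
  shows "rectifiable_arc D x y (linepath x y)"
proof -
  have "control (linepath x y) 0 1 (\<lambda>t. t * dist x y)"
    unfolding control_def
  proof (intro allI impI)
    fix s t :: real assume "s \<le> t"
    have "linepath x y s - linepath x y t = (t - s) *\<^sub>R (x - y)"
      by (simp add: linepath_def algebra_simps)
    then show "dist (linepath x y s) (linepath x y t) \<le> t * dist x y - s * dist x y"
      using \<open>s \<le> t\<close> by (simp only: dist_norm norm_scaleR) (simp add: left_diff_distrib)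
  qed
  then show ?thesis using assms unfolding rectifiable_arc_def curve_length_finite_iff
    by (auto simp: arc_linepath)
qed

text \<open>Within a ball contained in \<open>U\<close>, segments extend an arc from one point to
  any other, so reachability from \<open>x\<close> propagates through the connected set. The
  alternative \<open>y = x\<close> covers the point to which no arc can return.\<close>

lemma rectifiable_arc_exists:
  assumes "open U" "connected U" "x \<in> U" "y \<in> U" "x \<noteq> y"
  obtains g where "rectifiable_arc U x y g"
proof -
  have "y = x \<or> (\<exists>g. rectifiable_arc U x y g)"
  proof (rule connected_induction_simple[OF assms(2-4), where P = "\<lambda>y. y = x \<or> (\<exists>g. rectifiable_arc U x y g)"])
    fix a assume "a \<in> U"
    then obtain e where e: "e > 0" "ball a e \<subseteq> U" using \<open>open U\<close> openE by blast
    show "\<exists>T. openin (top_of_set U) T \<and> a \<in> T \<and>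
             (\<forall>p\<in>T. \<forall>q\<in>T. (p = x \<or> (\<exists>g. rectifiable_arc U x p g)) \<longrightarrow> (q = x \<or> (\<exists>g. rectifiable_arc U x q g)))"
    proof (intro exI[of _ "ball a e"] conjI ballI impI)
      show "openin (top_of_set U) (ball a e)" using e by (simp add: open_openin_trans \<open>open U\<close>)
      show "a \<in> ball a e" using e by simp
      fix p q assume pq: "p \<in> ball a e" "q \<in> ball a e" and p: "p = x \<or> (\<exists>g. rectifiable_arc U x p g)"
      have seg: "closed_segment p q \<subseteq> U"
        using closed_segment_subset[OF pq convex_ball] e by blast
      show "q = x \<or> (\<exists>g. rectifiable_arc U x q g)"
      proof (cases "p = q \<or> q = x")
        case False
        then have l: "rectifiable_arc U p q (linepath p q)" using seg by (intro rectifiable_arc_linepath) auto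
        then show ?thesis using p False by (metis rectifiable_arc_join)
      qed (use p in auto)
    qed
  qed auto
  then show ?thesis using that \<open>x \<noteq> y\<close> by auto
qed

section \<open>The internal distance as a metric\<close>

lemma internal_dist_self [simp]: "internal_dist D x x = 0"
  by (simp add: internal_dist_def)

lemma internal_dist_alt:
  "x \<noteq> y \<Longrightarrow> internal_dist D x y = (INF g\<in>Collect (rectifiable_arc D x y). diameter (path_image g))"
  by (simp add: internal_dist_def rectifiable_arc_def[abs_def])

lemma internal_dist_le:
  assumes "rectifiable_arc D x y g"
  shows "internal_dist D x y \<le> diameter (path_image g)"
proof -
  have "x \<noteq> y" using assms arc_distinct_ends[of g] by (auto simp: rectifiable_arc_def)
  then show ?thesis unfolding internal_dist_alt[OF \<open>x \<noteq> y\<close>] using assms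
    by (intro cINF_lower bdd_belowI2[of _ 0] diameter_ge_0 bounded_path_image)
       (auto simp: rectifiable_arc_def arc_imp_path)
qed

lemma internal_dist_approx:
  assumes D: "is_domain D" and "x \<in> D" "y \<in> D" "x \<noteq> y" "0 < e"
  obtains g where "rectifiable_arc D x y g" "diameter (path_image g) < internal_dist D x y + e"
proof -
  obtain g0 where g0: "rectifiable_arc D x y g0"
    using D assms(2-4) rectifiable_arc_exists[of D x y] unfolding is_domain_def by blast
  have "\<exists>g\<in>Collect (rectifiable_arc D x y). diameter (path_image g) < internal_dist D x y + e"
    unfolding internal_dist_alt[OF \<open>x \<noteq> y\<close>] using g0 \<open>0 < e\<close>
    by (subst cINF_less_iff[symmetric])
       (auto intro!: bdd_belowI2[of _ 0] diameter_ge_0 bounded_path_image simp: rectifiable_arc_def arc_imp_path)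
  then show ?thesis using that by auto
qed

lemma dist_le_internal_dist:
  assumes D: "is_domain D" and "x \<in> D" "y \<in> D"
  shows "dist x y \<le> internal_dist D x y"
proof (cases "x = y")
  case False
  show ?thesis
  proof (rule field_le_epsilon)
    fix e :: real assume "0 < e"
    then obtain g where g: "rectifiable_arc D x y g" "diameter (path_image g) < internal_dist D x y + e"
      using internal_dist_approx[OF D assms(2,3) False] by blast
    have "x \<in> path_image g" "y \<in> path_image g" "bounded (path_image g)"
      using g by (auto simp: rectifiable_arc_def arc_imp_path bounded_path_image)
    then show "dist x y \<le> internal_dist D x y + e"
      using diameter_bounded_bound[of "path_image g" x y] g(2) by linarith
  qed
qed auto

lemma internal_dist_nonneg:
  assumes D: "is_domain D" and "x \<in> D" "y \<in> D"
  shows "0 \<le> internal_dist D x y"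
  using dist_le_internal_dist[OF assms] zero_le_dist[of x y] by linarith

lemma internal_dist_commute: "internal_dist D x y = internal_dist D y x"
proof (cases "x = y")
  case False
  have *: "(\<lambda>g. diameter (path_image g)) ` Collect (rectifiable_arc D x y) \<subseteq>
           (\<lambda>g. diameter (path_image g)) ` Collect (rectifiable_arc D y x)" for x y :: 'a
    using rectifiable_arc_reverse by (force intro!: image_eqI[of _ _ "reversepath _"])
  then show ?thesis using False by (simp add: internal_dist_alt) (metis (no_types, lifting) subset_antisym)
qed auto

lemma diameter_Un_le:
  assumes "bounded S" "bounded T" "p \<in> S" "p \<in> T"
  shows "diameter (S \<union> T :: 'a::real_normed_vector set) \<le> diameter S + diameter T"
proof -
  have nn: "0 \<le> diameter S" "0 \<le> diameter T" using assms diameter_ge_0 by auto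
  have mix: "dist x y \<le> diameter S + diameter T" if "x \<in> S" "y \<in> T" for x y
    using diameter_bounded_bound[OF assms(1) that(1) assms(3)] diameter_bounded_bound[OF assms(2) assms(4) that(2)]
      dist_triangle[of x y p] by linarith
  have "dist x y \<le> diameter S + diameter T" if "x \<in> S \<union> T" "y \<in> S \<union> T" for x y
    using diameter_bounded_bound[OF assms(1), of x y] diameter_bounded_bound[OF assms(2), of x y]
      mix[of x y] mix[of y x] nn that by (auto simp: dist_commute)
  then show ?thesis using assms unfolding dist_norm by (intro diameter_le) auto
qed

text \<open>Two nearly optimal arcs share the point \<open>y\<close>, so the diameter of their union
  is at most the sum; \<open>rectifiable_arc_join\<close> finds an arc from \<open>x\<close> to
  \<open>z\<close> inside this union.\<close>

lemma internal_dist_triangle: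
  assumes D: "is_domain D" and "x \<in> D" "y \<in> D" "z \<in> D"
  shows "internal_dist D x z \<le> internal_dist D x y + internal_dist D y z"
proof (cases "x = y \<or> y = z \<or> x = z")
  case True
  then show ?thesis using internal_dist_nonneg[OF D] assms by auto
next
  case False
  show ?thesis
  proof (rule field_le_epsilon)
    fix e :: real assume "0 < e"
    then have e: "0 < e/2" by simp
    obtain g where g: "rectifiable_arc D x y g" "diameter (path_image g) < internal_dist D x y + e/2"
      using internal_dist_approx[OF D _ _ _ e, of x y] assms False by blast
    obtain h where h: "rectifiable_arc D y z h" "diameter (path_image h) < internal_dist D y z + e/2"
      using internal_dist_approx[OF D _ _ _ e, of y z] assms False by blast
    obtain k where k: "rectifiable_arc D x z k" "path_image k \<subseteq> path_image g \<union> path_image h"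
      using rectifiable_arc_join[OF g(1) h(1)] False by blast
    have b: "bounded (path_image g)" "bounded (path_image h)"
      using g h by (auto simp: rectifiable_arc_def arc_imp_path bounded_path_image)
    have "internal_dist D x z \<le> diameter (path_image k)" by (rule internal_dist_le[OF k(1)])
    also have "\<dots> \<le> diameter (path_image g \<union> path_image h)" using k b by (intro diameter_subset) auto
    also have "\<dots> \<le> diameter (path_image g) + diameter (path_image h)"
    proof (rule diameter_Un_le[OF b])
      show "y \<in> path_image g" using g pathfinish_in_path_image by (auto simp: rectifiable_arc_def)
      show "y \<in> path_image h" using h pathstart_in_path_image by (auto simp: rectifiable_arc_def)
    qed
    finally show "internal_dist D x z \<le> internal_dist D x y + internal_dist D y z + e" using g h by linarith
  qed
qed

section \<open>Internal distance against Euclidean diameter\<close>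

lemma internal_dist_le_diameter_open:
  assumes "open U" "connected U" "bounded U" "U \<subseteq> D" "x \<in> U" "y \<in> U"
  shows "internal_dist D x y \<le> diameter U"
proof (cases "x = y")
  case False
  obtain g where g: "rectifiable_arc U x y g"
    using rectifiable_arc_exists assms False by blast
  then have "rectifiable_arc D x y g" "path_image g \<subseteq> U" using assms by (auto simp: rectifiable_arc_def)
  then show ?thesis using internal_dist_le[of D x y g] diameter_subset[of "path_image g" U] assms by linarith
qed (use assms diameter_ge_0 in auto)

text \<open>A continuum may contain no rectifiable arc at all. A thin neighbourhood of it is open
  and connected, lies in \<open>D\<close>, contains rectifiable arcs between all its points, and has
  diameter at most \<open>diameter C + e\<close>.\<close>

lemma internal_dist_le_diameter:
  assumes D: "is_domain D" and C: "continuum C" "C \<subseteq> D" and xy: "x \<in> C" "y \<in> C"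
  shows "internal_dist D x y \<le> diameter C"
proof (rule field_le_epsilon)
  fix e :: real assume "0 < e"
  obtain d where d: "d > 0" "(\<Union>c\<in>C. ball c d) \<subseteq> D"
    using compact_subset_open_imp_ball_epsilon_subset[of C D] C D by (auto simp: continuum_def is_domain_def)
  \<comment> \<open>The bound \<open>d\<close> keeps the neighbourhood in \<open>D\<close>; the
    bound \<open>e / 2\<close> accounts for the two ends of a chord.\<close>
  define r where "r = min d (e / 2)"
  define U where "U = (\<Union>c\<in>C. ball c r)"
  have r: "0 < r" "r \<le> d" "r \<le> e / 2" using d \<open>0 < e\<close> by (auto simp: r_def)
  have bC: "bounded C" using C by (simp add: continuum_def compact_imp_bounded)
  have UD: "U \<subseteq> D" using d r by (force simp: U_def)
  have CU: "C \<subseteq> U" using r by (auto simp: U_def)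
  have diam: "norm (p - q) \<le> diameter C + e" if "p \<in> U" "q \<in> U" for p q
  proof -
    obtain c c' where c: "c \<in> C" "c' \<in> C" "dist c p < r" "dist c' q < r"
    proof -
      obtain c where c: "c \<in> C" "dist c p < r" using \<open>p \<in> U\<close> by (auto simp: U_def)
      obtain c' where c': "c' \<in> C" "dist c' q < r" using \<open>q \<in> U\<close> by (auto simp: U_def)
      show thesis using that[OF c(1) c'(1) c(2) c'(2)] .
    qed
    have "dist p q \<le> dist c p + dist c c' + dist c' q"
      using dist_triangle[of p q c] dist_triangle[of c q c'] by (simp add: dist_commute)
    then show ?thesis using c r diameter_bounded_bound[OF bC c(1,2)] by (simp add: dist_norm)
  qed
  have "connected U"
  proof -
    have "U = (\<Union>c\<in>C. C \<union> ball c r)" using CU xy by (auto simp: U_def)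
    moreover have "connected (\<Union>c\<in>C. C \<union> ball c r)"
    proof (rule connected_Union)
      show "connected S" if "S \<in> (\<lambda>c. C \<union> ball c r) ` C" for S
        using that C r by (auto simp: continuum_def intro!: connected_Un)
      show "\<Inter> ((\<lambda>c. C \<union> ball c r) ` C) \<noteq> {}" using xy by auto
    qed
    ultimately show ?thesis by simp
  qed
  moreover have "bounded U" unfolding bounded_any_center[where a = x]
    using diam CU xy by (auto simp: dist_norm intro!: exI[of _ "diameter C + e"])
  ultimately have "internal_dist D x y \<le> diameter U"
    using subsetD[OF CU xy(1)] subsetD[OF CU xy(2)] UD
    by (intro internal_dist_le_diameter_open) (auto simp: U_def intro!: open_UN)
  also have "\<dots> \<le> diameter C + e" using diam CU xy by (intro diameter_le) auto
  finally show "internal_dist D x y \<le> diameter C + e" .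
qed

text \<open>Close to \<open>x\<close> the segment to \<open>y\<close> lies in \<open>D\<close> and
  has diameter at most \<open>2 * dist x y\<close>; the triangle inequality does the rest.\<close>

lemma continuous_on_internal_dist:
  assumes D: "is_domain D" and "a \<in> D"
  shows "continuous_on D (internal_dist D a)"
  unfolding continuous_on_iff
proof (intro ballI allI impI)
  fix x and e :: real assume x: "x \<in> D" and "0 < e"
  obtain r where r: "0 < r" "ball x r \<subseteq> D" using D x by (meson is_domain_def openE)
  show "\<exists>d>0. \<forall>y\<in>D. dist y x < d \<longrightarrow> dist (internal_dist D a y) (internal_dist D a x) < e"
  proof (intro exI[of _ "min r (e / 2)"] conjI ballI impI)
    fix y assume y: "y \<in> D" "dist y x < min r (e / 2)"
    have "closed_segment x y \<subseteq> D"
      using r y closed_segment_subset[of x "ball x r" y] by (auto simp: dist_commute)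
    then have "internal_dist D x y \<le> diameter (closed_segment x y)"
      by (intro internal_dist_le_diameter[OF D]) (auto simp: continuum_def)
    moreover have "dist p q \<le> 2 * dist x y" if "p \<in> closed_segment x y" "q \<in> closed_segment x y" for p q
      using segment_bound(1)[OF that(1)] segment_bound(1)[OF that(2)] dist_triangle3[of p q x]
      by (simp add: dist_norm norm_minus_commute)
    then have "diameter (closed_segment x y) \<le> 2 * dist x y"
      by (intro diameter_le) (auto simp: dist_norm)
    ultimately have "internal_dist D x y < e" using y by (simp add: dist_commute)
    then show "dist (internal_dist D a y) (internal_dist D a x) < e"
      using internal_dist_triangle[OF D \<open>a \<in> D\<close> x y(1)] internal_dist_triangle[OF D \<open>a \<in> D\<close> y(1) x]
      by (simp add: dist_real_def internal_dist_commute[of D y x] abs_less_iff)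
  qed (use r \<open>0 < e\<close> in auto)
qed

subsection \<open>Weakly quasisymmetric maps of broad domains\<close>

lemma continuum_continuous_image:
  assumes "continuum C" "continuous_on C f"
  shows "continuum (f ` C)"
  using assms by (auto simp: continuum_def compact_continuous_image connected_continuous_image)

lemma continuum_curve:
  assumes "a \<le> b" "is_curve_in D ({a..b}, g)"
  shows "continuum (g ` {a..b})" "g ` {a..b} \<subseteq> D" "continuous_on {a..b} g"
  using assms continuum_continuous_image[of "{a..b}" g] by (auto simp: is_curve_in_def continuum_def)

text \<open>The diameter of \<open>C\<close> is at least the internal distance of \<open>p\<close>
  and \<open>q\<close>, and one end of a diametral pair has at least half of it as distance from
  \<open>z\<close>. This turns internal separation into Euclidean separation.\<close>

lemma continuum_far_point:
  assumes D: "is_domain D" and C: "continuum C" "C \<subseteq> D" and pq: "p \<in> C" "q \<in> C"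
  obtains w where "w \<in> C" "internal_dist D p q / 2 \<le> dist z w"
proof -
  obtain u v where uv: "u \<in> C" "v \<in> C" "dist u v = diameter C"
    using diameter_compact_attained[of C] C by (auto simp: continuum_def)
  then have "internal_dist D p q \<le> dist z u + dist z v"
    using internal_dist_le_diameter[OF D C pq] dist_triangle3[of u v z] by linarith
  then have "internal_dist D p q / 2 \<le> dist z u \<or> internal_dist D p q / 2 \<le> dist z v" by linarith
  then show ?thesis using that uv by blast
qed

text \<open>A point internally far from \<open>z\<close> may be close to \<open>z\<close> in the
  Euclidean metric. The curve through it nevertheless has large diameter, so it contains some other
  point \<open>w\<close> that is far in the Euclidean sense, and \<open>modulus_ring\<close>
  applies.\<close>

lemma modulus_internal_ring:
  fixes \<Gamma> :: "'a::euclidean_space curve set"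
  assumes D: "is_domain D" and z: "z \<in> D" and s: "0 < s" and N: "0 < N" and S: "s * 2 ^ N * 4 \<le> S"
    and \<Gamma>: "\<And>c. c \<in> \<Gamma> \<Longrightarrow> \<exists>a b g p q. c = ({a..b}, g) \<and> a \<le> b \<and> is_curve_in D c \<and>
      p \<in> g ` {a..b} \<and> q \<in> g ` {a..b} \<and> internal_dist D z p \<le> s \<and> S \<le> internal_dist D z q"
  shows "modulus \<Gamma> \<le> ennreal (ring_bound DIM('a) N)"
proof (rule modulus_ring[OF s N])
  fix c assume "c \<in> \<Gamma>"
  then obtain a b g p q where c: "c = ({a..b}, g)" "a \<le> b" "is_curve_in D c" "p \<in> g ` {a..b}"
    "q \<in> g ` {a..b}" "internal_dist D z p \<le> s" "S \<le> internal_dist D z q"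
    using \<Gamma>[OF \<open>c \<in> \<Gamma>\<close>] by blast
  note C = continuum_curve[OF c(2) c(3)[unfolded c(1)]]
  have pq: "p \<in> D" "q \<in> D" using c C by auto
  obtain w where w: "w \<in> g ` {a..b}" "internal_dist D p q / 2 \<le> dist z w"
    by (rule continuum_far_point[OF D C(1,2) c(4,5)])
  \<comment> \<open>The factor 4 in the hypothesis is used here: since \<open>s\<close> is at most
    \<open>X\<close>, the number \<open>(S - s) / 2\<close> is at least
    \<open>(4 * X - X) / 2\<close>, hence at least \<open>X\<close>.\<close>
  define X where "X = s * 2 ^ N"
  have "s * 1 \<le> X" unfolding X_def using s by (intro mult_left_mono) auto
  then have "X \<le> dist z w"
    using w(2) S[folded X_def] c(6,7) internal_dist_triangle[OF D z pq] \<open>0 < s\<close> by simp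
  then have "s * 2 ^ N \<le> dist z w" by (simp add: X_def)
  moreover have "dist z p \<le> s" using dist_le_internal_dist[OF D z pq(1)] c(6) by simp
  ultimately show "\<exists>a b g p q. c = ({a..b}, g) \<and> a \<le> b \<and> continuous_on {a..b} g \<and>
      p \<in> g ` {a..b} \<and> q \<in> g ` {a..b} \<and> dist z p \<le> s \<and> s * 2 ^ N \<le> dist z q"
    using c C w by blast
qed

text \<open>An arc in \<open>A\<close> from \<open>a\<close> to \<open>y\<close> is cut where its
  internal distance from \<open>a\<close> first reaches \<open>\<rho>\<close>. The piece joins two
  points at internal distance \<open>\<rho>\<close>, so its Euclidean diameter is at least
  \<open>\<rho>\<close>.\<close>

lemma initial_subcontinuum:
  assumes D: "is_domain D" and A: "A \<subseteq> D" "arcwise_connected A" and ay: "a \<in> A" "y \<in> A"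
    and \<rho>: "0 < \<rho>" "\<rho> \<le> internal_dist D a y"
  obtains C w where "continuum C" "C \<subseteq> A" "a \<in> C" "w \<in> C" "internal_dist D a w = \<rho>"
    "\<And>p. p \<in> C \<Longrightarrow> internal_dist D a p \<le> \<rho>" "\<rho> \<le> diameter C"
proof -
  have "a \<noteq> y" using \<rho> by auto
  then obtain g where g: "arc g" "path_image g \<subseteq> A" "pathstart g = a" "pathfinish g = y"
    using A ay unfolding arcwise_connected_def by blast
  define u where "u = (\<lambda>t. internal_dist D a (g t))"
  have cg: "continuous_on {0..1} g" using g(1) by (simp add: arc_def path_def)
  have gA: "g ` {0..1} \<subseteq> A" using g(2) by (simp add: path_image_def)
  have "continuous_on {0..1} u"
    unfolding u_def using A ay gA
    by (intro continuous_on_compose2[OF continuous_on_internal_dist[OF D] cg]) auto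
  moreover have "u 0 \<le> 0" "\<rho> \<le> u 1"
    using g \<rho> by (auto simp: u_def pathstart_def pathfinish_def)
  ultimately obtain s t where st: "0 \<le> s" "s \<le> t" "t \<le> 1" "u s = 0" "u t = \<rho>"
    "\<And>x. s < x \<Longrightarrow> x < t \<Longrightarrow> 0 < u x \<and> u x < \<rho>"
    using crossing_interval[of 0 1 u 0 \<rho>] \<rho>(1) by auto
  have gD: "g x \<in> D" if "0 \<le> x" "x \<le> 1" for x
    using subsetD[OF gA imageI, of x] A(1) that by auto
  have gs: "g s = a"
    using dist_le_internal_dist[OF D _ gD, of a s] A ay st by (auto simp: u_def)
  have C: "continuum (g ` {s..t})" using st continuous_on_subset[OF cg, of "{s..t}"]
    by (intro continuum_continuous_image) (auto simp: continuum_def)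
  show ?thesis
  proof (rule that[OF C])
    show CA: "g ` {s..t} \<subseteq> A" using gA st by auto
    show "a \<in> g ` {s..t}" using gs st by auto
    show gt: "g t \<in> g ` {s..t}" using st by auto
    show "internal_dist D a (g t) = \<rho>" using st by (simp add: u_def)
    show "internal_dist D a p \<le> \<rho>" if p: "p \<in> g ` {s..t}" for p
    proof -
      obtain x where x: "s \<le> x" "x \<le> t" "p = g x" using p by auto
      then have "u x \<le> \<rho>" using st(6)[of x] st(4,5) \<rho>(1) by (cases "x = s"; cases "x = t") auto
      then show ?thesis using x by (simp add: u_def)
    qed
    show "\<rho> \<le> diameter (g ` {s..t})"
      using internal_dist_le_diameter[OF D C _ \<open>a \<in> g ` {s..t}\<close> gt] CA A st by (auto simp: u_def)
  qed
qed

lemma joining_curvesE: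
  assumes "c \<in> joining_curves E F G"
  obtains a b g p q where "c = ({a..b}, g)" "a \<le> b" "is_curve_in G c" "p \<in> g ` {a..b}" "p \<in> E"
    "q \<in> g ` {a..b}" "q \<in> F"
proof -
  obtain a b g where c: "c = ({a..b}, g)" "a \<le> b" "is_curve_in G c" "g a \<in> E \<and> g b \<in> F \<or> g a \<in> F \<and> g b \<in> E"
    using assms by (auto simp: joining_curves_def)
  then show ?thesis using that[of a b g "g a" "g b"] that[of a b g "g b" "g a"] by auto
qed

lemma internal_setdist_le:
  assumes D: "is_domain D" and "C \<subseteq> D" "E \<subseteq> D" "x \<in> C" "y \<in> E"
  shows "internal_setdist D C E \<le> internal_dist D x y"
  unfolding internal_setdist_def using assms
  by (intro cINF_lower2[where x = "(x, y)"] bdd_belowI2[where m = 0])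
     (auto intro!: internal_dist_nonneg)

section \<open>Distortion estimates for one fixed map\<close>

locale weak_qs_map =
  fixes D D' :: "'a::euclidean_space set" and f :: "'a \<Rightarrow> 'a" and A :: "'a set"
    and K H :: real and \<phi> :: "real \<Rightarrow> real"
  assumes D: "is_domain D" and D': "is_domain D'" and qc: "quasiconformal K D D' f"
    and br: "broad \<phi> D" and AD: "A \<subseteq> D" and arcs: "arcwise_connected A"
    and weak: "\<And>a x y. \<lbrakk>a \<in> A; x \<in> A; y \<in> A; internal_dist D a x \<le> internal_dist D a y\<rbrakk> \<Longrightarrow>
      internal_dist D' (f a) (f x) \<le> H * internal_dist D' (f a) (f y)"
    and K: "1 \<le> K" and H: "1 \<le> H"
begin

abbreviation \<delta> where "\<delta> \<equiv> internal_dist D"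
abbreviation \<delta>' where "\<delta>' x y \<equiv> internal_dist D' (f x) (f y)"

lemma homeo: obtains g where "homeomorphism D D' f g"
  using qc by (auto simp: quasiconformal_def)

lemma cont_f: "continuous_on D f" and image_f: "f ` D = D'" and inj_f: "inj_on f D"
proof -
  obtain g where "homeomorphism D D' f g" by (rule homeo)
  then show "continuous_on D f" "f ` D = D'" "inj_on f D"
    by (auto simp: homeomorphism_def intro: inj_on_inverseI)
qed

text \<open>Relative openness in the open set \<open>D'\<close> is openness; this makes the images
  of annuli Borel sets.\<close>

lemma open_image_f: "open U \<Longrightarrow> U \<subseteq> D \<Longrightarrow> open (f ` U)"
proof -
  assume U: "open U" "U \<subseteq> D"
  obtain g where g: "homeomorphism D D' f g" by (rule homeo)
  then have "openin (top_of_set D') (f ` U)"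
    by (rule homeomorphism_imp_open_map) (use U D in \<open>auto simp: openin_open is_domain_def intro!: exI[of _ U]\<close>)
  then show "open (f ` U)" using D' by (simp add: is_domain_def openin_open_eq)
qed

lemma f_in: "x \<in> D \<Longrightarrow> f x \<in> D'" using image_f by auto

lemma nonneg: "x \<in> D \<Longrightarrow> y \<in> D \<Longrightarrow> 0 \<le> \<delta> x y" "x \<in> D \<Longrightarrow> y \<in> D \<Longrightarrow> 0 \<le> \<delta>' x y"
  using internal_dist_nonneg[OF D] internal_dist_nonneg[OF D'] f_in by auto

lemma pos': "x \<in> D \<Longrightarrow> y \<in> D \<Longrightarrow> x \<noteq> y \<Longrightarrow> 0 < \<delta>' x y"
  using dist_le_internal_dist[OF D' f_in f_in, of x y] inj_f
  by (metis inj_onD less_le_trans zero_less_dist_iff)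

lemma pos: "x \<in> D \<Longrightarrow> y \<in> D \<Longrightarrow> x \<noteq> y \<Longrightarrow> 0 < \<delta> x y"
  using dist_le_internal_dist[OF D, of x y] by (metis less_le_trans zero_less_dist_iff)

lemma triangle: "x \<in> D \<Longrightarrow> y \<in> D \<Longrightarrow> z \<in> D \<Longrightarrow> \<delta> x z \<le> \<delta> x y + \<delta> y z"
  by (rule internal_dist_triangle[OF D])

lemma triangle': "x \<in> D \<Longrightarrow> y \<in> D \<Longrightarrow> z \<in> D \<Longrightarrow> \<delta>' x z \<le> \<delta>' x y + \<delta>' y z"
  by (intro internal_dist_triangle[OF D'] f_in)

lemma curve_image:
  assumes "is_curve_in D (I, g)"
  shows "is_curve_in D' (I, f \<circ> g)"
proof -
  have "continuous_on I (\<lambda>t. f (g t))"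
    using assms by (intro continuous_on_compose2[OF cont_f]) (auto simp: is_curve_in_def)
  then show ?thesis using assms image_f by (auto simp: is_curve_in_def o_def)
qed

lemma modulus_image:
  assumes "\<And>c. c \<in> \<Gamma> \<Longrightarrow> is_curve_in D c"
  shows "ennreal (1 / K) * modulus \<Gamma> \<le> modulus (image_family f \<Gamma>)"
  using qc assms by (simp add: quasiconformal_def)

text \<open>The constant is the one at which the ring between radii \<open>H * r\<close> and
  \<open>R / (1 + H)\<close> becomes wide enough for \<open>modulus_internal_ring\<close> with
  \<open>N\<close>. If \<open>\<delta> a x \<le> \<delta> a y\<close>, weak quasisymmetry
  suffices.\<close>

lemma large_scale:
  assumes N: "0 < N" "ring_bound DIM('a) N < \<phi> (2 * t) / K" and t: "0 < t"
    and axy: "a \<in> A" "x \<in> A" "y \<in> A" and le: "\<delta> a x \<le> t * \<delta> a y"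
  shows "\<delta>' a x \<le> 4 * H * (1 + H) * 2 ^ N * \<delta>' a y"
proof (cases "\<delta> a x \<le> \<delta> a y")
  case True
  have "1 * 1 \<le> (1 + H) * 2 ^ N" using H by (intro mult_mono) auto
  then have "1 * (H * \<delta>' a y) \<le> (4 * ((1 + H) * 2 ^ N)) * (H * \<delta>' a y)"
    using H nonneg(2)[of a y] axy AD by (intro mult_right_mono mult_nonneg_nonneg) auto
  then have "H * \<delta>' a y \<le> 4 * H * (1 + H) * 2 ^ N * \<delta>' a y" by (simp only: mult_ac mult_1)
  then show ?thesis using weak[OF axy True] by linarith
next
  case False
  have inD: "a \<in> D" "x \<in> D" "y \<in> D" using axy AD by auto
  define r where "r = \<delta>' a y"
  define R where "R = \<delta>' a x"
  have "y \<noteq> a" using le False nonneg(1)[of a x] inD by auto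
  have r: "0 < r" using pos' inD \<open>y \<noteq> a\<close> by (simp add: r_def)
  have ay: "0 < \<delta> a y" using pos inD \<open>y \<noteq> a\<close> by simp
  show ?thesis
  proof (rule ccontr)
    assume "\<not> ?thesis"
    then have big: "4 * H * (1 + H) * 2 ^ N * r < R" by (simp add: r_def R_def)
    obtain C0 w0 where C0: "continuum C0" "C0 \<subseteq> A" "a \<in> C0" "\<And>p. p \<in> C0 \<Longrightarrow> \<delta> a p \<le> \<delta> a y"
      "\<delta> a y \<le> diameter C0"
      using initial_subcontinuum[OF D AD arcs axy(1,3) ay order_refl] by metis
    have "0 < \<delta> a x / 2" "\<delta> a x / 2 \<le> \<delta> x a"
      using False ay by (auto simp: internal_dist_commute[of D x a])
    then obtain C1 w1 where C1: "continuum C1" "C1 \<subseteq> A" "x \<in> C1" "\<And>p. p \<in> C1 \<Longrightarrow> \<delta> x p \<le> \<delta> a x / 2"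
      "\<delta> a x / 2 \<le> diameter C1"
      using initial_subcontinuum[OF D AD arcs axy(2,1)] by metis
    have near: "\<delta>' a p \<le> H * r" if "p \<in> C0" for p
      using weak[of a p y] that C0 axy by (auto simp: r_def)
    \<comment> \<open>The radius \<open>\<delta> a x / 2\<close> of \<open>C1\<close> makes
      \<open>p\<close> at least as close to \<open>x\<close> as to \<open>a\<close>, so weak
      quasisymmetry centred at \<open>p\<close> bounds \<open>\<delta>' p x\<close> by
      \<open>H * \<delta>' p a\<close>.\<close>
    have far: "R / (1 + H) \<le> \<delta>' a p" if p: "p \<in> C1" for p
    proof -
      have pA: "p \<in> A" "p \<in> D" using p C1 AD by auto
      have "\<delta> p x \<le> \<delta> p a"
        using C1(4)[OF p] triangle[of a p x] inD pA by (simp add: internal_dist_commute[of D _ p])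
      then have "\<delta>' p x \<le> H * \<delta>' p a" using weak pA axy by blast
      then have "R \<le> (1 + H) * \<delta>' a p"
        using triangle'[of a p x] inD pA
        by (simp add: R_def internal_dist_commute[of D' "f p" "f a"] algebra_simps)
      then show ?thesis using H by (simp add: field_simps)
    qed
    have Hr: "H * r * 2 ^ N * 4 < R / (1 + H)" using big H by (simp add: field_simps)
    have "H * r * 1 \<le> H * r * (2 ^ N * 4)"
      using H r mult_mono[of 1 "2 ^ N" 1 "4::real"] by (intro mult_left_mono) auto
    then have sep: "H * r < R / (1 + H)" using Hr by simp
    have disj: "C0 \<inter> C1 = {}" using near far sep by force
    define \<Gamma> where "\<Gamma> = joining_curves C0 C1 D"
    \<comment> \<open>Both diameters are at least \<open>\<delta> a y / 2\<close>, while the sets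
      are at distance at most \<open>t * \<delta> a y\<close>; hence the argument
      \<open>2 * t\<close> of \<open>\<phi>\<close>.\<close>
    have "internal_setdist D C0 C1 \<le> \<delta> a x"
      using C0 C1 AD by (intro internal_setdist_le[OF D]) auto
    also have "\<dots> \<le> 2 * t * (\<delta> a y / 2)" using le by simp
    also have "\<dots> \<le> 2 * t * min (diameter C0) (diameter C1)"
      using C0(5) C1(5) False ay t by (intro mult_left_mono) auto
    finally have "ennreal (\<phi> (2 * t)) \<le> modulus \<Gamma>"
      using br C0 C1 disj AD t unfolding broad_def \<Gamma>_def by (metis mult_pos_pos subset_trans zero_less_numeral)
    then have "ennreal (1 / K) * ennreal (\<phi> (2 * t)) \<le> ennreal (1 / K) * modulus \<Gamma>"
      by (intro mult_left_mono) auto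
    also have "\<dots> \<le> modulus (image_family f \<Gamma>)"
      by (intro modulus_image) (auto simp: \<Gamma>_def joining_curves_def)
    also have "\<dots> \<le> ennreal (ring_bound DIM('a) N)"
    proof (rule modulus_internal_ring[OF D' f_in[OF inD(1)] _ N(1) less_imp_le[OF Hr]])
      fix c assume "c \<in> image_family f \<Gamma>"
      then obtain I h where ih: "c = (I, f \<circ> h)" "(I, h) \<in> joining_curves C0 C1 D"
        by (auto simp: image_family_def \<Gamma>_def)
      obtain \<alpha> \<beta> p q where c: "I = {\<alpha>..\<beta>}" "\<alpha> \<le> \<beta>" "is_curve_in D (I, h)" "p \<in> h ` {\<alpha>..\<beta>}" "p \<in> C0"
        "q \<in> h ` {\<alpha>..\<beta>}" "q \<in> C1"
        using joining_curvesE[OF ih(2)] by (metis prod.inject)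
      have "c = ({\<alpha>..\<beta>}, f \<circ> h) \<and> \<alpha> \<le> \<beta> \<and> is_curve_in D' c \<and> f p \<in> (f \<circ> h) ` {\<alpha>..\<beta>} \<and>
          f q \<in> (f \<circ> h) ` {\<alpha>..\<beta>} \<and> \<delta>' a p \<le> H * r \<and> R / (1 + H) \<le> \<delta>' a q"
        using c ih curve_image near far by auto
      then show "\<exists>\<alpha> \<beta> g p q. c = ({\<alpha>..\<beta>}, g) \<and> \<alpha> \<le> \<beta> \<and> is_curve_in D' c \<and> p \<in> g ` {\<alpha>..\<beta>} \<and>
         q \<in> g ` {\<alpha>..\<beta>} \<and> internal_dist D' (f a) p \<le> H * r \<and> R / (1 + H) \<le> internal_dist D' (f a) q"
        by blast
    qed (use H r in auto)
    finally have "ennreal (\<phi> (2 * t) / K) \<le> ennreal (ring_bound DIM('a) N)"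
      using K by (simp add: ennreal_mult'[symmetric])
    then show False using N ring_bound_nonneg[of "DIM('a)" N] by (simp add: ennreal_le_iff)
  qed
qed

text \<open>At scale \<open>e\<close>, broadness supplies curves of large modulus; the ones leaving the internal annulus
  of ratio \<open>4 ^ (M + 3)\<close> contribute little.\<close>

lemma annulus_family:
  assumes M: "0 < M" "ring_bound DIM('a) M < \<phi> 20 / 4"
    and axy: "a \<in> A" "x \<in> A" "y \<in> A" and e: "0 < e" "2 * e \<le> \<delta> a y" "\<delta> a x \<le> 3 / 16 * e"
  obtains \<Gamma> where "ennreal (\<phi> 20 / 2) \<le> modulus \<Gamma>"
    "\<And>c. c \<in> \<Gamma> \<Longrightarrow> \<exists>\<alpha> \<beta> g p q. c = ({\<alpha>..\<beta>}, g) \<and> \<alpha> \<le> \<beta> \<and> is_curve_in D c \<and>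
       g ` {\<alpha>..\<beta>} \<subseteq> {u. e / 2 ^ (M + 3) < \<delta> a u \<and> \<delta> a u < 2 ^ (M + 3) * e} \<and>
       p \<in> g ` {\<alpha>..\<beta>} \<and> q \<in> g ` {\<alpha>..\<beta>} \<and> \<delta>' a p \<le> H * \<delta>' a y \<and> \<delta>' a x \<le> H\<^sup>2 * \<delta>' p q"
proof -
  have inD: "a \<in> D" "x \<in> D" "y \<in> D" using axy AD by auto
  have "e \<le> \<delta> a y" "0 < e / 4" "e / 4 \<le> \<delta> a y" using e by auto
  \<comment> \<open>Two base points at internal distances \<open>e\<close> and \<open>e / 4\<close>
    from \<open>a\<close>. The continua around them have radii \<open>e / 4\<close> and
    \<open>e / 16\<close>, so they lie in the separate shells \<open>3/4 * e\<close> to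
    \<open>5/4 * e\<close> and \<open>3/16 * e\<close> to \<open>5/16 * e\<close>.\<close>
  obtain x1 where x1: "x1 \<in> A" "\<delta> a x1 = e"
    using initial_subcontinuum[OF D AD arcs axy(1,3) e(1) \<open>e \<le> \<delta> a y\<close>] by (metis subsetD)
  obtain y1 where y1: "y1 \<in> A" "\<delta> a y1 = e / 4"
    using initial_subcontinuum[OF D AD arcs axy(1,3) \<open>0 < e / 4\<close> \<open>e / 4 \<le> \<delta> a y\<close>] by (metis subsetD)
  have in1: "x1 \<in> D" "y1 \<in> D" using x1 y1 AD by auto
  have "e / 4 \<le> \<delta> x1 a" "e / 16 \<le> \<delta> y1 a" "0 < e / 16"
    using x1 y1 e by (auto simp: internal_dist_commute[of D _ a])
  obtain C where C: "continuum C" "C \<subseteq> A" "x1 \<in> C" "\<And>p. p \<in> C \<Longrightarrow> \<delta> x1 p \<le> e / 4" "e / 4 \<le> diameter C"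
    using initial_subcontinuum[OF D AD arcs x1(1) axy(1) \<open>0 < e / 4\<close> \<open>e / 4 \<le> \<delta> x1 a\<close>] by metis
  obtain E where E: "continuum E" "E \<subseteq> A" "y1 \<in> E" "\<And>p. p \<in> E \<Longrightarrow> \<delta> y1 p \<le> e / 16" "e / 16 \<le> diameter E"
    using initial_subcontinuum[OF D AD arcs y1(1) axy(1) \<open>0 < e / 16\<close> \<open>e / 16 \<le> \<delta> y1 a\<close>] by metis
  have pC: "3 / 4 * e \<le> \<delta> a p" "\<delta> a p \<le> 5 / 4 * e" if "p \<in> C" for p
  proof -
    have "p \<in> D" using that C AD by auto
    then show "3 / 4 * e \<le> \<delta> a p" "\<delta> a p \<le> 5 / 4 * e"
      using C(4)[OF that] triangle[of a x1 p] triangle[of a p x1] inD in1 x1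
      by (auto simp: internal_dist_commute[of D p x1])
  qed
  have qE: "3 / 16 * e \<le> \<delta> a q" "\<delta> a q \<le> 5 / 16 * e" if "q \<in> E" for q
  proof -
    have "q \<in> D" using that E AD by auto
    then show "3 / 16 * e \<le> \<delta> a q" "\<delta> a q \<le> 5 / 16 * e"
      using E(4)[OF that] triangle[of a y1 q] triangle[of a q y1] inD in1 y1
      by (auto simp: internal_dist_commute[of D q y1])
  qed
  have disj: "C \<inter> E = {}" using pC(1) qE(2) e(1) by force
  define J where "J = joining_curves C E D"
  define V where "V = {u. e / 2 ^ (M + 3) < \<delta> a u \<and> \<delta> a u < 2 ^ (M + 3) * e}"
  define \<Gamma> where "\<Gamma> = {c \<in> J. snd c ` fst c \<subseteq> V}"
  \<comment> \<open>\<open>B1\<close> holds the curves that leave the annulus outwards and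
    \<open>B2\<close> those that leave it inwards. The first start from \<open>E\<close> and the
    second from \<open>C\<close>, as seen from the boundary of the annulus, so each crosses a wide
    ring around \<open>a\<close>. The summand 3 in the exponent provides the factor 4 required by
    \<open>modulus_internal_ring\<close>.\<close>
  define B1 where "B1 = {c \<in> J. \<exists>u \<in> snd c ` fst c. 2 ^ (M + 3) * e \<le> \<delta> a u}"
  define B2 where "B2 = {c \<in> J. \<exists>u \<in> snd c ` fst c. \<delta> a u \<le> e / 2 ^ (M + 3)}"
  have "J \<subseteq> (\<Gamma> \<union> B1) \<union> B2" by (auto simp: \<Gamma>_def B1_def B2_def V_def not_less)
  have B1: "modulus B1 \<le> ennreal (ring_bound DIM('a) M)"
  proof (rule modulus_internal_ring[OF D inD(1) _ M(1), where s = "5 / 16 * e" and S = "2 ^ (M + 3) * e"])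
    fix c assume "c \<in> B1"
    then obtain u where c: "c \<in> joining_curves C E D" "u \<in> snd c ` fst c" "2 ^ (M + 3) * e \<le> \<delta> a u"
      by (auto simp: B1_def J_def)
    obtain \<alpha> \<beta> g p q where "c = ({\<alpha>..\<beta>}, g)" "\<alpha> \<le> \<beta>" "is_curve_in D c" "p \<in> g ` {\<alpha>..\<beta>}" "p \<in> C"
      "q \<in> g ` {\<alpha>..\<beta>}" "q \<in> E" by (rule joining_curvesE[OF c(1)])
    then show "\<exists>\<alpha> \<beta> g p q. c = ({\<alpha>..\<beta>}, g) \<and> \<alpha> \<le> \<beta> \<and> is_curve_in D c \<and> p \<in> g ` {\<alpha>..\<beta>} \<and>
      q \<in> g ` {\<alpha>..\<beta>} \<and> \<delta> a p \<le> 5 / 16 * e \<and> 2 ^ (M + 3) * e \<le> \<delta> a q"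
      using c qE by (metis fst_conv snd_conv)
  qed (use e in \<open>auto simp: power_add\<close>)
  have B2: "modulus B2 \<le> ennreal (ring_bound DIM('a) M)"
  proof (rule modulus_internal_ring[OF D inD(1) _ M(1), where s = "e / 2 ^ (M + 3)" and S = "3 / 4 * e"])
    fix c assume "c \<in> B2"
    then obtain u where c: "c \<in> joining_curves C E D" "u \<in> snd c ` fst c" "\<delta> a u \<le> e / 2 ^ (M + 3)"
      by (auto simp: B2_def J_def)
    obtain \<alpha> \<beta> g p q where "c = ({\<alpha>..\<beta>}, g)" "\<alpha> \<le> \<beta>" "is_curve_in D c" "p \<in> g ` {\<alpha>..\<beta>}" "p \<in> C"
      "q \<in> g ` {\<alpha>..\<beta>}" "q \<in> E" by (rule joining_curvesE[OF c(1)])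
    then show "\<exists>\<alpha> \<beta> g p q. c = ({\<alpha>..\<beta>}, g) \<and> \<alpha> \<le> \<beta> \<and> is_curve_in D c \<and> p \<in> g ` {\<alpha>..\<beta>} \<and>
      q \<in> g ` {\<alpha>..\<beta>} \<and> \<delta> a p \<le> e / 2 ^ (M + 3) \<and> 3 / 4 * e \<le> \<delta> a q"
      using c pC by (metis fst_conv snd_conv)
  qed (use e in \<open>auto simp: power_add\<close>)
  \<comment> \<open>The number 20 arises as \<open>(e + e / 4) / (e / 16)\<close>, with
    \<open>e / 16\<close> a lower bound for both diameters.\<close>
  have "internal_setdist D C E \<le> \<delta> x1 y1"
    using C E AD by (intro internal_setdist_le[OF D]) auto
  also have "\<dots> \<le> 20 * (e / 16)"
    using triangle[of x1 a y1] in1 inD x1 y1 by (simp add: internal_dist_commute[of D x1 a])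
  also have "\<dots> \<le> 20 * min (diameter C) (diameter E)"
    using C(5) E(5) e by (intro mult_left_mono) auto
  finally have "ennreal (\<phi> 20) \<le> modulus J"
    using br C E disj AD unfolding broad_def J_def by (metis subset_trans zero_less_numeral)
  also have "\<dots> \<le> modulus (\<Gamma> \<union> B1) + modulus B2"
    using modulus_mono[OF \<open>J \<subseteq> (\<Gamma> \<union> B1) \<union> B2\<close>] modulus_Un_le order_trans by blast
  also have "\<dots> \<le> (modulus \<Gamma> + ennreal (ring_bound DIM('a) M)) + ennreal (ring_bound DIM('a) M)"
    using B1 B2 modulus_Un_le[of \<Gamma> B1] by (intro add_mono) (auto intro: order_trans)
  also have "\<dots> = modulus \<Gamma> + ennreal (2 * ring_bound DIM('a) M)"
    using ring_bound_nonneg[of "DIM('a)" M] by (simp add: add.assoc ennreal_plus[symmetric] del: ennreal_plus)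
  \<comment> \<open>The two discarded families cost less than \<open>\<phi> 20 / 4\<close> each, so
    half of \<open>\<phi> 20\<close> remains.\<close>
  also have "\<dots> \<le> modulus \<Gamma> + ennreal (\<phi> 20 / 2)"
    using M by (intro add_left_mono ennreal_leI) auto
  finally have "ennreal (\<phi> 20 / 2) + ennreal (\<phi> 20 / 2) \<le> modulus \<Gamma> + ennreal (\<phi> 20 / 2)"
    using M ring_bound_nonneg[of "DIM('a)" M] by (simp add: ennreal_plus[symmetric] del: ennreal_plus)
  then have "ennreal (\<phi> 20 / 2) \<le> modulus \<Gamma>"
    by (subst (asm) (1 2) add.commute) (simp add: ennreal_add_left_cancel_le)
  then show ?thesis
  proof (rule that)
    fix c assume c: "c \<in> \<Gamma>"
    then have "c \<in> joining_curves C E D" by (simp add: \<Gamma>_def J_def)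
    then obtain \<alpha> \<beta> g p q where g: "c = ({\<alpha>..\<beta>}, g)" "\<alpha> \<le> \<beta>" "is_curve_in D c" "p \<in> g ` {\<alpha>..\<beta>}" "p \<in> C"
      "q \<in> g ` {\<alpha>..\<beta>}" "q \<in> E" by (rule joining_curvesE)
    have pq: "p \<in> A" "q \<in> A" "p \<in> D" "q \<in> D" using g C E AD by auto
    have "\<delta>' a p \<le> H * \<delta>' a y" using pC[OF g(5)] e pq axy by (intro weak) auto
    moreover have "\<delta>' a x \<le> H\<^sup>2 * \<delta>' p q"
    proof -
      have 1: "\<delta>' a x \<le> H * \<delta>' a q" using qE[OF g(7)] e pq axy by (intro weak) auto
      \<comment> \<open>The left side is at most \<open>5/16 * e\<close>, the right side at least
        \<open>3/4 * e - 5/16 * e\<close>.\<close>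
      have "\<delta> q a \<le> \<delta> q p"
        using triangle[of a q p] inD pq pC[OF g(5)] qE[OF g(7)] e by (simp add: internal_dist_commute[of D q a])
      then have "\<delta>' q a \<le> H * \<delta>' q p" using pq axy by (intro weak) auto
      then have "H * \<delta>' a q \<le> H * (H * \<delta>' p q)"
        using H by (intro mult_left_mono) (auto simp: internal_dist_commute[of D' "f q"])
      then show ?thesis using 1 by (simp add: power2_eq_square mult.assoc)
    qed
    moreover have "g ` {\<alpha>..\<beta>} \<subseteq> V" using c g by (simp add: \<Gamma>_def)
    ultimately show "\<exists>\<alpha> \<beta> g p q. c = ({\<alpha>..\<beta>}, g) \<and> \<alpha> \<le> \<beta> \<and> is_curve_in D c \<and>
       g ` {\<alpha>..\<beta>} \<subseteq> {u. e / 2 ^ (M + 3) < \<delta> a u \<and> \<delta> a u < 2 ^ (M + 3) * e} \<and>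
       p \<in> g ` {\<alpha>..\<beta>} \<and> q \<in> g ` {\<alpha>..\<beta>} \<and> \<delta>' a p \<le> H * \<delta>' a y \<and> \<delta>' a x \<le> H\<^sup>2 * \<delta>' p q"
      using g unfolding V_def by blast
  qed
qed

text \<open>The bound on \<open>t\<close> leaves room for exactly the scales
  \<open>\<delta> a y / 4 ^ ((M + 3) * i)\<close> with \<open>i\<close> from 1 to \<open>N\<close>.
  Each image family charges its own part of one ball, which produces the factor
  \<open>N\<close>.\<close>

lemma small_scale:
  assumes M: "0 < M" "ring_bound DIM('a) M < \<phi> 20 / 4"
    and axy: "a \<in> A" "x \<in> A" "y \<in> A" and t: "t \<le> 3 / 16 / 4 ^ ((M + 3) * N)" and le: "\<delta> a x \<le> t * \<delta> a y"
  shows "real N * (\<phi> 20 / (2 * K)) * \<delta>' a x ^ DIM('a) \<le>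
     unit_ball_vol DIM('a) * (4 * H ^ 3 * \<delta>' a y) ^ DIM('a)"
proof -
  have inD: "a \<in> D" "x \<in> D" "y \<in> D" using axy AD by auto
  define r where "r = \<delta>' a x"
  define R where "R = \<delta>' a y"
  \<comment> \<open>Annuli reach from \<open>d i / \<sigma>\<close> to
    \<open>\<sigma> * d i\<close>; the ratio \<open>\<Lambda> = \<sigma> * \<sigma>\<close> of
    successive scales is what makes them disjoint.\<close>
  define \<Lambda> :: real where "\<Lambda> = 4 ^ (M + 3)"
  define \<sigma> :: real where "\<sigma> = 2 ^ (M + 3)"
  have \<Lambda>: "\<Lambda> = \<sigma> * \<sigma>" by (simp add: \<Lambda>_def \<sigma>_def power_mult_distrib[symmetric])
  have \<sigma>: "8 \<le> \<sigma>" by (simp add: \<sigma>_def power_add)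
  have \<Lambda>2: "2 \<le> \<Lambda>" using \<sigma> mult_mono[of 2 \<sigma> 1 \<sigma>] by (simp add: \<Lambda>)
  show ?thesis
  proof (cases "x = a")
    case True
    then show ?thesis using H nonneg(2)[OF inD(1,3)] by (simp add: power_0_left)
  next
    case False
    have r: "0 < r" using pos'[OF inD(1,2)] False by (simp add: r_def)
    have ax: "0 < \<delta> a x" using pos[OF inD(1,2)] False by simp
    have "3 / 16 / 4 ^ ((M + 3) * N) \<le> 3 / 16 / (1::real)" by (intro divide_left_mono) auto
    then have "t \<le> 1" using t by linarith
    have ay: "0 < \<delta> a y" using ax le nonneg(1)[OF inD(1,3)] by (cases "\<delta> a y = 0") auto
    define d where "d = (\<lambda>i::nat. \<delta> a y / \<Lambda> ^ i)"
    have "\<delta> a x \<le> \<delta> a y" using le mult_right_mono[OF \<open>t \<le> 1\<close> less_imp_le[OF ay]] by simp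
    then have rR: "r \<le> H * R" using weak axy by (simp add: r_def R_def)
    have dpos: "0 < d i" for i using ay \<Lambda>2 by (simp add: d_def)
    have dle: "2 * d i \<le> \<delta> a y" "\<delta> a x \<le> 3 / 16 * d i" if i: "i \<in> {1..N}" for i
    proof -
      have "\<Lambda> ^ 1 \<le> \<Lambda> ^ i" using i \<Lambda>2 by (intro power_increasing) auto
      then have "2 \<le> \<Lambda> ^ i" using \<Lambda>2 by simp
      then show "2 * d i \<le> \<delta> a y" using ay \<Lambda>2 by (simp add: d_def field_simps)
      have "\<Lambda> ^ i \<le> \<Lambda> ^ N" using i \<Lambda>2 by (intro power_increasing) auto
      then have "3 / 16 * (\<delta> a y / \<Lambda> ^ N) \<le> 3 / 16 * d i"
        unfolding d_def using ay \<Lambda>2 by (intro mult_left_mono divide_left_mono) auto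
      moreover have "t * \<delta> a y \<le> 3 / 16 / \<Lambda> ^ N * \<delta> a y"
        using t ay by (intro mult_right_mono) (auto simp: \<Lambda>_def power_mult)
      ultimately show "\<delta> a x \<le> 3 / 16 * d i" using le by simp
    qed
    define U where "U = (\<lambda>i. {u \<in> D. d i / \<sigma> < \<delta> a u \<and> \<delta> a u < \<sigma> * d i})"
    have openU: "open (U i)" for i
    proof -
      have "open (D \<inter> \<delta> a -` {d i / \<sigma><..<\<sigma> * d i})"
        using D by (intro continuous_open_preimage continuous_on_internal_dist inD) (auto simp: is_domain_def)
      then show ?thesis by (simp add: U_def vimage_def Int_def conj_ac)
    qed
    have disjU: "U i \<inter> U j = {}" if "i < j" for i j
    proof -
      have "\<Lambda> ^ Suc i \<le> \<Lambda> ^ j" using that \<Lambda>2 by (intro power_increasing) auto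
      then have "d j \<le> \<delta> a y / \<Lambda> ^ Suc i"
        unfolding d_def using ay \<Lambda>2 by (intro divide_left_mono) auto
      also have "\<dots> = d i / \<Lambda>" by (simp add: d_def)
      finally have "\<sigma> * d j \<le> \<sigma> * (d i / \<Lambda>)" using \<sigma> by (intro mult_left_mono) auto
      also have "\<dots> = d i / \<sigma>" using \<sigma> by (simp add: \<Lambda>)
      finally show ?thesis by (auto simp: U_def)
    qed
    define V where "V = (\<lambda>i. f ` U i \<inter> ball (f a) (2 * H * R))"
    have UD: "U i \<subseteq> D" for i by (auto simp: U_def)
    have [measurable]: "V i \<in> sets borel" for i
      unfolding V_def using open_image_f[OF openU UD] by (intro borel_open open_Int) auto
    have disjV: "disjoint_family_on V {1..N}"
      unfolding disjoint_family_on_def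
    proof (intro ballI impI)
      fix i j :: nat assume "i \<noteq> j"
      then have "U i \<inter> U j = {}" using disjU[of i j] disjU[of j i] by (metis Int_commute linorder_neqE_nat)
      then have "f ` U i \<inter> f ` U j = {}"
        using inj_on_image_Int[OF inj_f UD UD, of i j] by simp
      then show "V i \<inter> V j = {}" by (auto simp: V_def)
    qed
    \<comment> \<open>An image curve contains \<open>f p\<close> and \<open>f q\<close> at internal
      distance at least \<open>r / H\<^sup>2\<close>, so it reaches Euclidean distance at least half
      of that from \<open>f p\<close>. The weight \<open>1 / \<beta>\<close> on \<open>V i\<close>
      is therefore admissible.\<close>
    define \<beta> where "\<beta> = r / (2 * H\<^sup>2)"
    have \<beta>: "0 < \<beta>" using r H by (simp add: \<beta>_def)
    have "1 \<le> 2 * H\<^sup>2" using one_le_power[OF H, of 2] by linarith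
    then have "\<beta> \<le> r" using r H by (simp add: \<beta>_def field_simps)
    have each: "ennreal (\<phi> 20 / (2 * K)) \<le> ennreal ((1 / \<beta>) ^ DIM('a)) * emeasure lborel (V i)" if i: "i \<in> {1..N}" for i
    proof -
      obtain \<Gamma> where \<Gamma>: "ennreal (\<phi> 20 / 2) \<le> modulus \<Gamma>" and
        \<Gamma>c: "\<And>c. c \<in> \<Gamma> \<Longrightarrow> \<exists>\<alpha> \<beta> g p q. c = ({\<alpha>..\<beta>}, g) \<and> \<alpha> \<le> \<beta> \<and> is_curve_in D c \<and>
         g ` {\<alpha>..\<beta>} \<subseteq> {u. d i / \<sigma> < \<delta> a u \<and> \<delta> a u < \<sigma> * d i} \<and>
         p \<in> g ` {\<alpha>..\<beta>} \<and> q \<in> g ` {\<alpha>..\<beta>} \<and> \<delta>' a p \<le> H * \<delta>' a y \<and> \<delta>' a x \<le> H\<^sup>2 * \<delta>' p q"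
        using annulus_family[OF M axy dpos dle[OF i]] unfolding \<sigma>_def by blast
      have "ennreal (\<phi> 20 / (2 * K)) = ennreal (1 / K) * ennreal (\<phi> 20 / 2)"
        using K by (simp add: ennreal_mult'[symmetric] mult.commute)
      also have "\<dots> \<le> ennreal (1 / K) * modulus \<Gamma>" using \<Gamma> by (intro mult_left_mono) auto
      also have "\<dots> \<le> modulus (image_family f \<Gamma>)" using \<Gamma>c by (intro modulus_image) blast
      also have "\<dots> \<le> (\<integral>\<^sup>+ u. (ennreal (1 / \<beta>) * indicator (V i) u) ^ DIM('a) \<partial>lborel)"
      proof (rule modulus_le, unfold admissible_def, intro conjI ballI impI)
        fix c assume c: "c \<in> image_family f \<Gamma>" "locally_rectifiable c"
        then obtain I g where ig: "c = (I, f \<circ> g)" "(I, g) \<in> \<Gamma>" by (auto simp: image_family_def)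
        obtain \<alpha> \<beta>' p q where g: "I = {\<alpha>..\<beta>'}" "\<alpha> \<le> \<beta>'" "is_curve_in D (I, g)"
          "g ` {\<alpha>..\<beta>'} \<subseteq> {u. d i / \<sigma> < \<delta> a u \<and> \<delta> a u < \<sigma> * d i}" "p \<in> g ` {\<alpha>..\<beta>'}" "q \<in> g ` {\<alpha>..\<beta>'}"
          "\<delta>' a p \<le> H * R" "r \<le> H\<^sup>2 * \<delta>' p q"
          using \<Gamma>c[OF ig(2)] unfolding r_def R_def by blast
        have C: "continuum ((f \<circ> g) ` {\<alpha>..\<beta>'})" "(f \<circ> g) ` {\<alpha>..\<beta>'} \<subseteq> D'" "continuous_on {\<alpha>..\<beta>'} (f \<circ> g)"
          using continuum_curve[OF g(2), of D' "f \<circ> g"] curve_image g(1,3) by auto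
        have gD: "g ` {\<alpha>..\<beta>'} \<subseteq> D" using g(1,3) by (auto simp: is_curve_in_def)
        have fp: "f p \<in> (f \<circ> g) ` {\<alpha>..\<beta>'}" "f q \<in> (f \<circ> g) ` {\<alpha>..\<beta>'}" using g(5,6) by auto
        obtain w where w: "w \<in> (f \<circ> g) ` {\<alpha>..\<beta>'}" "\<delta>' p q / 2 \<le> dist (f p) w"
          by (rule continuum_far_point[OF D' C(1,2) fp])
        have "\<beta> \<le> \<delta>' p q / 2" using g(8) H by (simp add: \<beta>_def field_simps)
        have fin: "curve_length (f \<circ> g) \<alpha> \<beta>' < \<infinity>"
          using c(2) g(1,2) ig(1) by (auto simp: locally_rectifiable_def)
        \<comment> \<open>A single shell, the punctured ball of radius \<open>\<beta>\<close> around
          \<open>f p\<close>. It stays in the ball defining \<open>V i\<close>, because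
          \<open>f p\<close> is within \<open>H * R\<close> of \<open>f a\<close> and
          \<open>\<beta> \<le> r \<le> H * R\<close>.\<close>
        have "(\<Sum>k\<in>{()}. ennreal (1 / \<beta>) * ennreal (\<beta> - 0)) \<le>
            line_integral (\<lambda>u. ennreal (1 / \<beta>) * indicator (V i) u) ({\<alpha>..\<beta>'}, f \<circ> g)"
        proof (rule line_integral_ge_sum[OF C(3) g(2) fin fp(1) w(1), where z = "f p" and S = "\<lambda>_. V i"])
          fix u assume u: "u \<in> (f \<circ> g) ` {\<alpha>..\<beta>'}" "dist (f p) u < \<beta>"
          have pD: "p \<in> D" using g(5) gD by auto
          have "dist (f a) (f p) \<le> H * R" using dist_le_internal_dist[OF D' f_in f_in] inD pD g(7) by force
          then have "dist (f a) u < 2 * H * R"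
            using dist_triangle[of "f a" u "f p"] u(2) \<open>\<beta> \<le> r\<close> rR by linarith
          moreover have "u \<in> f ` U i" using u(1) g(4) gD by (force simp: U_def)
          ultimately show "u \<in> V i" by (simp add: V_def)
        qed (use \<beta> w \<open>\<beta> \<le> \<delta>' p q / 2\<close> in auto)
        then show "1 \<le> line_integral (\<lambda>u. ennreal (1 / \<beta>) * indicator (V i) u) c"
          using \<beta> g(1) ig(1) by (simp add: ennreal_mult[symmetric])
      qed measurable
      also have "\<dots> = (\<integral>\<^sup>+ u. ennreal ((1 / \<beta>) ^ DIM('a)) * indicator (V i) u \<partial>lborel)"
        using \<beta> by (intro nn_integral_cong) (auto simp: indicator_def ennreal_power power_0_left)
      also have "\<dots> = ennreal ((1 / \<beta>) ^ DIM('a)) * emeasure lborel (V i)"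
        by (intro nn_integral_cmult_indicator) simp
      finally show ?thesis .
    qed
    have HR: "0 \<le> H * R" using r rR by linarith
    have m: "0 \<le> \<phi> 20" using M ring_bound_nonneg[of "DIM('a)" M] by simp
    have "ennreal (real N * (\<phi> 20 / (2 * K))) = (\<Sum>i\<in>{1..N}. ennreal (\<phi> 20 / (2 * K)))"
      using K m by (simp add: ennreal_mult[symmetric] ennreal_of_nat_eq_real_of_nat)
    also have "\<dots> \<le> (\<Sum>i\<in>{1..N}. ennreal ((1 / \<beta>) ^ DIM('a)) * emeasure lborel (V i))"
      by (intro sum_mono each)
    \<comment> \<open>Disjointness of the sets \<open>V i\<close> turns the sum of \<open>N\<close>
      volumes into the volume of one subset of the ball.\<close>
    also have "\<dots> = ennreal ((1 / \<beta>) ^ DIM('a)) * emeasure lborel (\<Union>i\<in>{1..N}. V i)"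
      using disjV by (simp add: sum_distrib_left[symmetric] sum_emeasure image_subset_iff)
    also have "\<dots> \<le> ennreal ((1 / \<beta>) ^ DIM('a)) * emeasure lborel (ball (f a) (2 * (H * R)))"
      by (intro mult_left_mono emeasure_mono) (auto simp: V_def mult.assoc)
    also have "\<dots> = ennreal ((1 / \<beta>) ^ DIM('a) * (unit_ball_vol DIM('a) * (2 * (H * R)) ^ DIM('a)))"
      using HR \<beta> by (subst emeasure_ball) (auto simp: ennreal_mult[symmetric])
    finally have "real N * (\<phi> 20 / (2 * K)) \<le> (1 / \<beta>) ^ DIM('a) * (unit_ball_vol DIM('a) * (2 * (H * R)) ^ DIM('a))"
      using HR \<beta> by (subst (asm) ennreal_le_iff) auto
    then have "real N * (\<phi> 20 / (2 * K)) * r ^ DIM('a) \<le>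
        (1 / \<beta>) ^ DIM('a) * (unit_ball_vol DIM('a) * (2 * (H * R)) ^ DIM('a)) * r ^ DIM('a)"
      using r by (intro mult_right_mono) auto
    also have "\<dots> = unit_ball_vol DIM('a) * (1 / \<beta> * (2 * (H * R)) * r) ^ DIM('a)"
      by (simp only: power_mult_distrib mult_ac)
    also have "1 / \<beta> * (2 * (H * R)) * r = 4 * H ^ 3 * R"
      using r H by (simp add: \<beta>_def field_simps power3_eq_cube power2_eq_square)
    finally show ?thesis by (simp add: r_def R_def)
  qed
qed

end

subsection \<open>Constructing the gauge\<close>

lemma integral_mono_bounds:
  fixes g :: "real \<Rightarrow> real"
  assumes g: "mono_on {a..b} g" and "a \<le> b"
  shows "(b - a) * g a \<le> integral {a..b} g" "integral {a..b} g \<le> (b - a) * g b"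
proof -
  have i: "g integrable_on {a..b}" by (rule integrable_on_mono_on[OF g])
  have "integral {a..b} (\<lambda>_. g a) \<le> integral {a..b} g"
    using assms by (intro integral_le i) (auto simp: mono_on_def)
  then show "(b - a) * g a \<le> integral {a..b} g" using \<open>a \<le> b\<close> by simp
  have "integral {a..b} g \<le> integral {a..b} (\<lambda>_. g b)"
    using assms by (intro integral_le i) (auto simp: mono_on_def)
  then show "integral {a..b} g \<le> (b - a) * g b" using \<open>a \<le> b\<close> by simp
qed

text \<open>Averaging a nondecreasing \<open>g\<close> over \<open>{0..2 * t}\<close> makes it continuous and keeps it above \<open>g t\<close>.\<close>

lemma homeomorphism_majorant:
  fixes g :: "real \<Rightarrow> real"
  assumes mono: "mono_on {0..} g" and g0: "g 0 = 0"
    and lim: "\<And>e. 0 < e \<Longrightarrow> \<exists>t>0. g t < e"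
  obtains \<eta> \<theta> where "homeomorphism {0..} {0..} \<eta> \<theta>" "\<eta> 0 = 0" "\<And>t. 0 < t \<Longrightarrow> t + g t \<le> \<eta> t"
proof -
  define F where "F = (\<lambda>t. integral {0..t} g)"
  \<comment> \<open>The quotient is twice the mean of \<open>g\<close> over
    \<open>{0..2 * t}\<close>, already at least \<open>g t\<close> because of the half
    \<open>{t..2 * t}\<close>. The summand \<open>t\<close> makes the function strictly increasing
    and unbounded.\<close>
  define \<eta> where "\<eta> = (\<lambda>t. if t \<le> 0 then 0 else t + F (2 * t) / t)"
  have mono': "mono_on {a..b} g" if "0 \<le> a" for a b
    using mono that by (auto simp: mono_on_def)
  have int: "g integrable_on {a..b}" if "0 \<le> a" for a b
    by (rule integrable_on_mono_on[OF mono'[OF that]])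
  have split: "F b = F a + integral {a..b} g" if "0 \<le> a" "a \<le> b" for a b
    unfolding F_def using Henstock_Kurzweil_Integration.integral_combine[OF that int] by simp
  have gnn: "0 \<le> g t" if "0 \<le> t" for t using mono g0 that by (force simp: mono_on_def)
  have Fub: "F t \<le> t * g t" if "0 \<le> t" for t
    using integral_mono_bounds(2)[OF mono'[of 0 t]] that by (simp add: F_def)
  have Fnn: "0 \<le> F t" if "0 \<le> t" for t
    using integral_mono_bounds(1)[OF mono'[of 0 t]] that g0 by (simp add: F_def)
  have lower: "t + g t \<le> \<eta> t" if "0 < t" for t
  proof -
    have "t * g t \<le> F (2 * t)"
      using split[of t "2 * t"] integral_mono_bounds(1)[OF mono'[of t "2 * t"]] Fnn[of t] that by simp
    then show ?thesis using that by (simp add: \<eta>_def field_simps)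
  qed
  have upper: "\<eta> t \<le> t + 2 * g (2 * t)" if "0 < t" for t
    using Fub[of "2 * t"] that by (simp add: \<eta>_def field_simps)
  \<comment> \<open>The mean of a nondecreasing function over a growing interval does not decrease:
    what is added is at least \<open>g (2 * s)\<close>, which bounds the old mean.\<close>
  have avg: "F (2 * s) / s \<le> F (2 * t) / t" if "0 < s" "s < t" for s t
  proof -
    have "F (2 * t) \<ge> F (2 * s) + (2 * t - 2 * s) * g (2 * s)"
      using split[of "2 * s" "2 * t"] integral_mono_bounds(1)[OF mono'[of "2 * s" "2 * t"]] that by simp
    then have "s * F (2 * t) \<ge> s * F (2 * s) + (t - s) * (2 * s * g (2 * s))"
      using that mult_left_mono[of "F (2 * s) + (2 * t - 2 * s) * g (2 * s)" "F (2 * t)" s]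
      by (simp add: algebra_simps)
    moreover have "(t - s) * (2 * s * g (2 * s)) \<ge> (t - s) * F (2 * s)"
      using that Fub[of "2 * s"] by (intro mult_left_mono) auto
    ultimately have "s * F (2 * t) \<ge> t * F (2 * s)" by (simp add: algebra_simps)
    then show ?thesis using that by (simp add: field_simps)
  qed
  have smono: "\<eta> s < \<eta> t" if "0 \<le> s" "s < t" for s t
  proof (cases "s = 0")
    case True
    then show ?thesis using lower[of t] gnn[of t] that by (simp add: \<eta>_def)
  next
    case False
    then show ?thesis using avg[of s t] that by (simp add: \<eta>_def)
  qed
  have cont: "continuous_on {0..} \<eta>"
    unfolding continuous_on_eq_continuous_within
  proof (intro ballI)
    fix x :: real assume "x \<in> {0..}"
    show "continuous (at x within {0..}) \<eta>"
    proof (cases "x = 0")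
      case True
      show ?thesis unfolding True continuous_within_eps_delta
      proof (intro allI impI)
        fix e :: real assume "0 < e"
        \<comment> \<open>Continuity at 0 comes from \<open>upper\<close>: for small
          \<open>y\<close> the value is at most \<open>y + 2 * g (2 * y)\<close>, with
          \<open>2 * y \<le> t\<close>.\<close>
        then obtain t where t: "0 < t" "g t < e / 4" using lim[of "e / 4"] by auto
        show "\<exists>d>0. \<forall>y\<in>{0..}. dist y 0 < d \<longrightarrow> dist (\<eta> y) (\<eta> 0) < e"
        proof (intro exI[of _ "min (t / 2) (e / 2)"] conjI ballI impI)
          fix y :: real assume y: "y \<in> {0..}" "dist y 0 < min (t / 2) (e / 2)"
          show "dist (\<eta> y) (\<eta> 0) < e"
          proof (cases "y = 0")
            case False
            then have "0 < y" "2 * y \<le> t" "y < e / 2" using y by auto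
            moreover from this have "g (2 * y) \<le> g t" using mono by (auto simp: mono_on_def)
            ultimately have "\<eta> y < e" "0 \<le> \<eta> y"
              using upper[of y] lower[of y] gnn[of y] t by linarith+
            then show ?thesis by (simp add: \<eta>_def)
          qed (use \<open>0 < e\<close> in simp)
        qed (use t \<open>0 < e\<close> in auto)
      qed
    next
      case False
      then have "0 < x" using \<open>x \<in> {0..}\<close> by simp
      have "continuous_on {0..2 * x + 2} F"
        unfolding F_def by (intro indefinite_integral_continuous_1 int) simp
      then have "isCont F (2 * x)" using \<open>0 < x\<close> by (intro continuous_on_interior) auto
      then have "isCont (\<lambda>t. F (2 * t)) x"
        using isCont_o2[of x "\<lambda>t. 2 * t" F] by simp
      then have "isCont (\<lambda>t. t + F (2 * t) / t) x"
        using \<open>0 < x\<close> by (intro isCont_add isCont_divide continuous_ident) auto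
      moreover have "eventually (\<lambda>t. t + F (2 * t) / t = \<eta> t) (nhds x)"
        using eventually_nhds_in_open[of "{0<..}" x] \<open>0 < x\<close>
        by (auto elim!: eventually_mono simp: \<eta>_def)
      ultimately have "isCont \<eta> x" using isCont_cong[of "\<lambda>t. t + F (2 * t) / t" \<eta> x] by simp
      then show ?thesis by (rule continuous_at_imp_continuous_at_within)
    qed
  qed
  have "\<eta> ` {0..} = {0..}"
  proof (intro equalityI subsetI)
    fix y assume "y \<in> \<eta> ` {0..}"
    then obtain t where "0 \<le> t" "y = \<eta> t" by auto
    then show "y \<in> {0..}" using smono[of 0 t] by (cases "t = 0") (auto simp: \<eta>_def)
  next
    fix y :: real assume "y \<in> {0..}"
    then have y: "0 \<le> y" by simp
    have "\<eta> 0 \<le> y" "y \<le> \<eta> y"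
      using y lower[of y] gnn[of y] by (auto simp: \<eta>_def split: if_splits)
    then obtain t where "0 \<le> t" "\<eta> t = y"
      using IVT'[of \<eta> 0 y y] continuous_on_subset[OF cont, of "{0..y}"] y by auto
    then show "y \<in> \<eta> ` {0..}" by auto
  qed
  moreover have "inj_on \<eta> {0..}"
    by (rule inj_onI) (metis atLeast_iff less_irrefl linorder_neqE smono)
  ultimately obtain \<theta> where "homeomorphism {0..} {0..} \<eta> \<theta>"
    using homeomorphism_into_1d[of "{0..}" \<eta> "{0..}"] cont by (auto simp: convex_imp_path_connected)
  then show ?thesis using that lower by (auto simp: \<eta>_def)
qed

text \<open>Read \<open>P t c\<close> as saying that \<open>c\<close> is a valid distortion bound at
  ratio \<open>t\<close>. The infimum of valid bounds is monotone and tends to 0 with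
  \<open>t\<close>, so it has a homeomorphic majorant.\<close>

lemma homeomorphism_selection:
  fixes P :: "real \<Rightarrow> real \<Rightarrow> bool"
  assumes ex: "\<And>t. 0 < t \<Longrightarrow> \<exists>c. P t c" and small: "\<And>e. 0 < e \<Longrightarrow> \<exists>t>0. P t e"
    and up: "\<And>s t c d. \<lbrakk>P t c; 0 < s; s \<le> t; c \<le> d\<rbrakk> \<Longrightarrow> P s d"
  obtains \<eta> \<theta> where "homeomorphism {0..} {0..} \<eta> \<theta>" "\<eta> 0 = 0" "\<And>t. 0 < t \<Longrightarrow> P t (\<eta> t)"
proof -
  define g where "g = (\<lambda>t. if t \<le> 0 then 0 else Inf {c. 0 \<le> c \<and> P t c})"
  have ne: "{c. 0 \<le> c \<and> P t c} \<noteq> {}" if t: "0 < t" for t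
  proof -
    obtain c where "P t c" using ex[OF t] by blast
    then have "P t (max 0 c)" using up[of t c t "max 0 c"] t by simp
    then show ?thesis by (auto intro!: exI[of _ "max 0 c"])
  qed
  have bdd: "bdd_below {c. 0 \<le> c \<and> P t c}" for t by (auto intro: bdd_belowI[of _ 0])
  have le: "g t \<le> c" if "0 < t" "P t c" "0 \<le> c" for t c
    using that bdd by (auto simp: g_def intro: cInf_lower)
  have nn: "0 \<le> g t" for t
    using ne[of t] by (auto simp: g_def simp del: Collect_empty_eq intro!: cInf_greatest)
  \<comment> \<open>The infimum need not be attained; the slack \<open>t\<close> brings the value
    strictly above it.\<close>
  have P: "P t (t + g t)" if t: "0 < t" for t
  proof -
    have "Inf {c. 0 \<le> c \<and> P t c} < t + g t" using t by (simp add: g_def)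
    then obtain c where "P t c" "c < t + g t" using cInf_lessD[OF ne[OF t]] by blast
    then show ?thesis using up[of t c t "t + g t"] t by simp
  qed
  have mono: "mono_on {0..} g"
  proof (rule mono_onI)
    fix s t :: real assume st: "s \<in> {0..}" "t \<in> {0..}" "s \<le> t"
    show "g s \<le> g t"
    proof (cases "s \<le> 0")
      case False
      have "Inf {c. 0 \<le> c \<and> P s c} \<le> Inf {c. 0 \<le> c \<and> P t c}"
        using False st ne[of t] bdd up[of t _ s] by (intro cInf_superset_mono) auto
      then show ?thesis using False st by (simp add: g_def)
    qed (use nn[of t] in \<open>simp add: g_def\<close>)
  qed
  have lim: "\<exists>t>0. g t < e" if "0 < e" for e
  proof -
    obtain t where "0 < t" "P t (e / 2)" using small[of "e / 2"] \<open>0 < e\<close> by auto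
    then show ?thesis using le[of t "e / 2"] that by (intro exI[of _ t]) auto
  qed
  have "g 0 = 0" by (simp add: g_def)
  obtain \<eta> \<theta> where \<eta>: "homeomorphism {0..} {0..} \<eta> \<theta>" "\<eta> 0 = 0"
    "\<And>t. 0 < t \<Longrightarrow> t + g t \<le> \<eta> t"
    using homeomorphism_majorant[OF mono \<open>g 0 = 0\<close> lim] by blast
  then show ?thesis using that P up by (metis order_refl)
qed

section \<open>One gauge for all domains and maps\<close>

theorem theorem1:
  fixes K H :: real and \<phi> :: "real \<Rightarrow> real"
  assumes "CARD('n::finite) \<ge> 2"
    and "K \<ge> 1" and "H \<ge> 1"
    and "\<exists>\<psi>. homeomorphism {0<..} {0<..} \<phi> \<psi>" and "strict_antimono_on {0<..} \<phi>"
  shows "\<exists>\<eta> :: real \<Rightarrow> real. (\<exists>\<theta>. homeomorphism {0..} {0..} \<eta> \<theta>) \<and>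
    (\<forall>(D :: (real ^ 'n) set) (D' :: (real ^ 'n) set) (f :: real ^ 'n \<Rightarrow> real ^ 'n) A.
       is_domain D \<and> is_domain D' \<and> quasiconformal K D D' f \<and> broad \<phi> D \<and>
       A \<subseteq> D \<and> arcwise_connected A \<and>
       weakly_quasisymmetric H A (internal_dist D) (f ` A) (internal_dist D') f \<longrightarrow>
       quasisymmetric \<eta> A (internal_dist D) (f ` A) (internal_dist D') f)"
proof -
  \<comment> \<open>All domains, maps and sets \<open>A\<close> are quantified inside
    \<open>P\<close>, so a gauge selected for \<open>P\<close> depends only on the dimension,
    \<open>K\<close>, \<open>H\<close> and \<open>\<phi>\<close>.\<close>
  define P where "P = (\<lambda>t c. \<forall>(D :: (real ^ 'n) set) D' f A a x y. weak_qs_map D D' f A K H \<phi> \<longrightarrow>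
    a \<in> A \<longrightarrow> x \<in> A \<longrightarrow> y \<in> A \<longrightarrow> internal_dist D a x \<le> t * internal_dist D a y \<longrightarrow>
    internal_dist D' (f a) (f x) \<le> c * internal_dist D' (f a) (f y))"
  have dim: "2 \<le> DIM(real ^ 'n)" using assms(1) by simp
  have \<phi>pos: "0 < \<phi> t" if "0 < t" for t
    using assms(4) that by (auto simp: homeomorphism_def)
  have "\<exists>c. P t c" if "0 < t" for t
  proof -
    obtain N where "0 < N" "ring_bound DIM(real ^ 'n) N < \<phi> (2 * t) / K"
      using ring_bound_small[OF dim, of "\<phi> (2 * t) / K"] \<phi>pos[of "2 * t"] \<open>0 < t\<close> assms(2) by auto
    then have "P t (4 * H * (1 + H) * 2 ^ N)"
      unfolding P_def using weak_qs_map.large_scale \<open>0 < t\<close> by blast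
    then show ?thesis by blast
  qed
  moreover have "\<exists>t>0. P t e" if "0 < e" for e
  proof -
    let ?n = "DIM(real ^ 'n)"
    have m: "0 < \<phi> 20" using \<phi>pos by simp
    obtain M where M: "0 < M" "ring_bound ?n M < \<phi> 20 / 4"
      using ring_bound_small[OF dim, of "\<phi> 20 / 4"] m by auto
    define \<omega> where "\<omega> = unit_ball_vol (real ?n) * (4 * H ^ 3) ^ ?n"
    have \<omega>: "0 < \<omega>" using assms(3) by (simp add: \<omega>_def)
    define k where "k = \<phi> 20 / (2 * K) * e ^ ?n"
    have k: "0 < k" using m assms(2) \<open>0 < e\<close> by (simp add: k_def)
    \<comment> \<open>The number of scales is chosen so that \<open>small_scale\<close>, after
      cancelling \<open>\<omega>\<close>, yields the factor \<open>e ^ ?n\<close>.\<close>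
    obtain N :: nat where "\<omega> / k < real N" using reals_Archimedean2 by blast
    then have "\<omega> \<le> real N * k" using k by (simp add: pos_divide_less_eq less_imp_le)
    then have N: "\<omega> \<le> real N * (\<phi> 20 / (2 * K)) * e ^ ?n" by (simp only: k_def mult.assoc)
    define t :: real where "t = 3 / 16 / 4 ^ ((M + 3) * N)"
    have "P t e"
      unfolding P_def
    proof (intro allI impI)
      fix D D' :: "(real ^ 'n) set" and f A a x y
      assume w: "weak_qs_map D D' f A K H \<phi>" and axy: "a \<in> A" "x \<in> A" "y \<in> A"
        and le: "internal_dist D a x \<le> t * internal_dist D a y"
      interpret weak_qs_map D D' f A K H \<phi> by (rule w)
      have in_D: "a \<in> D" "x \<in> D" "y \<in> D" using axy AD by auto
      have "\<omega> * \<delta>' a x ^ ?n \<le> real N * (\<phi> 20 / (2 * K)) * e ^ ?n * \<delta>' a x ^ ?n"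
        using nonneg(2)[OF in_D(1,2)] by (intro mult_right_mono N) auto
      also have "\<dots> = e ^ ?n * (real N * (\<phi> 20 / (2 * K)) * \<delta>' a x ^ ?n)" by (simp only: mult_ac)
      also have "\<dots> \<le> e ^ ?n * (unit_ball_vol ?n * (4 * H ^ 3 * \<delta>' a y) ^ ?n)"
        using \<open>0 < e\<close> small_scale[OF M axy _ le] by (intro mult_left_mono) (auto simp: t_def)
      also have "\<dots> = \<omega> * (e * \<delta>' a y) ^ ?n" by (simp only: \<omega>_def power_mult_distrib mult_ac)
      finally have "\<delta>' a x ^ ?n \<le> (e * \<delta>' a y) ^ ?n" using \<omega> by simp
      then show "\<delta>' a x \<le> e * \<delta>' a y"
        using nonneg(2)[OF in_D(1,3)] \<open>0 < e\<close> by (subst (asm) power_mono_iff) (auto simp: nonneg(2)[OF in_D(1,2)])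
    qed
    then show ?thesis by (intro exI[of _ t]) (auto simp: t_def)
  qed
  moreover have "P s d" if P: "P t c" and st: "0 < s" "s \<le> t" "c \<le> d" for s t c d
    unfolding P_def
  proof (intro allI impI)
    fix D D' :: "(real ^ 'n) set" and f A a x y
    assume w: "weak_qs_map D D' f A K H \<phi>" and axy: "a \<in> A" "x \<in> A" "y \<in> A"
      and le: "internal_dist D a x \<le> s * internal_dist D a y"
    interpret weak_qs_map D D' f A K H \<phi> by (rule w)
    have in_D: "a \<in> D" "y \<in> D" using axy AD by auto
    have "s * \<delta> a y \<le> t * \<delta> a y" using st nonneg(1)[OF in_D] by (intro mult_right_mono) auto
    then have "\<delta>' a x \<le> c * \<delta>' a y" using P w axy le unfolding P_def by (meson order_trans)
    also have "\<dots> \<le> d * \<delta>' a y" using st nonneg(2)[OF in_D] by (intro mult_right_mono) auto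
    finally show "\<delta>' a x \<le> d * \<delta>' a y" .
  qed
  ultimately obtain \<eta> \<theta> where \<eta>: "homeomorphism {0..} {0..} \<eta> \<theta>" "\<eta> 0 = 0" "\<And>t. 0 < t \<Longrightarrow> P t (\<eta> t)"
    using homeomorphism_selection[of P] by blast
  show ?thesis
  proof (intro exI[of _ \<eta>] conjI exI[of _ \<theta>] \<eta>(1) allI impI, elim conjE)
    fix D D' :: "(real ^ 'n) set" and f A
    assume hyps: "is_domain D" "is_domain D'" "quasiconformal K D D' f" "broad \<phi> D" "A \<subseteq> D" "arcwise_connected A"
      and wqs: "weakly_quasisymmetric H A (internal_dist D) (f ` A) (internal_dist D') f"
    have w: "weak_qs_map D D' f A K H \<phi>"
      using hyps wqs assms by unfold_locales (auto simp: weakly_quasisymmetric_def)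
    then interpret weak_qs_map D D' f A K H \<phi> .
    show "quasisymmetric \<eta> A (internal_dist D) (f ` A) (internal_dist D') f"
      unfolding quasisymmetric_def
    proof (intro conjI ballI allI impI)
      show "metric_embedding A \<delta> (f ` A) (internal_dist D') f"
        using wqs by (simp add: weakly_quasisymmetric_def)
      fix a x y t assume axy: "a \<in> A" "x \<in> A" "y \<in> A" and t: "0 \<le> t" and le: "\<delta> a x \<le> t * \<delta> a y"
      show "\<delta>' a x \<le> \<eta> t * \<delta>' a y"
      proof (cases "t = 0")
        \<comment> \<open>\<open>P\<close> speaks of positive ratios only; at ratio 0 the hypothesis
          forces \<open>x = a\<close> and both sides vanish.\<close>
        case True
        then have "x = a" using le pos[of a x] axy AD by force
        then show ?thesis using True \<eta>(2) by simp
      next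
        case False
        then show ?thesis using \<eta>(3)[of t] w axy le t unfolding P_def by auto
      qed
    qed
  qed
qed

end
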